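(* Let $\Gamma$, $D$ and $\gamma$ be as described in the context, and take any sequence $\gamma(t_N)=(x(t_N),y(t_N))$, $N\in\mathbb{N}$, $t_N\ge 0$, such that $\lim_{N\to\infty}\gamma(t_N)=0$. If $u\in\mathcal{O}(D)\cap C(\overline{D})$, then the formula $$ u(z)=\frac{1}{2\pi i}\lim_{N\to\infty}\int_{\Gamma}\frac{u(\zeta)}{\zeta-z}\left(\frac{z-\gamma(t_N)}{\zeta-\gamma(t_N)}\right)^{N+1}d\zeta $$ holds for any point $z\in D$, where the convergence is uniform in $z$ on compact subsets of $D$.
   Context: $\mathbb{C}$ is the complex plane of $z=x+iy$ with $x,y\in\mathbb{R}$, and points $(x,y)\in\mathbb{R}^2$ are identified with $x+iy\in\mathbb{C}$. $B(0,1)=\{z\in\mathbb{C}:|z|<1\}$ is the unit disk. $\mathcal{O}(D)$ is the space of functions holomorphic in the open set $D$, and $C(\overline{D})$ is the space of functions continuous on the closure $\overline{D}$. $\Gamma$ is a smooth curve in $B(0,1)$ dividing $B(0,1)$ into two domains, and $D$ denotes that one of these domains which does not contain the origin (such domains are called lunes). $\Gamma$ is oriented as part of the positively oriented boundary $\partial D$. Further, $\gamma(t)=(x(t),y(t))$, $t\ge 0$, with $\gamma(0)=0$, is a smooth curve with end point the origin which lies in $B(0,1)\setminus D$; the curves $\Gamma$ and $\gamma$ intersect transversally at the origin. Any curve $\gamma$ with these properties is fixed.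
   Formalization: If the origin lies on Γ, t_N is required to be nonzero for all large N (at t_N = 0 the integral diverges, e.g. u = 1); γ is taken without self-intersections and not returning toward the origin, and Γ is regular C¹ up to its end points. *)

theory Defs
  imports "HOL-Complex_Analysis.Complex_Analysis"
begin

(* \<open>C1_differentiable_on\<close> asks for two-sided derivatives also at the end points of the
   parameter interval.  This is no restriction: a map that is C1 up to an end point has a
   C1 extension beyond it, and the values outside the interval are never used. *)

text \<open>The curve \<open>\<Gamma>\<close> is represented by an oriented regular C1 parametrization \<open>g\<close> on
  \<open>{0..1}\<close> whose end points may lie on the unit circle; \<open>\<Gamma>\<close> itself is the part of the path
  in the open disk.\<close>

definition curve_in_disk :: "(real \<Rightarrow> complex) \<Rightarrow> complex set" where
  "curve_in_disk g = path_image g \<inter> ball 0 1"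

definition smooth_curve_in_disk :: "(real \<Rightarrow> complex) \<Rightarrow> bool" where
  "smooth_curve_in_disk g \<longleftrightarrow>
     simple_path g \<and>
     g C1_differentiable_on {0..1} \<and>
     (\<forall>s\<in>{0..1}. vector_derivative g (at s) \<noteq> 0) \<and>
     path_image g \<subseteq> cball 0 1 \<and>
     g ` {0<..<1} \<subseteq> ball 0 1"

definition divides_disk_into_two_domains :: "(real \<Rightarrow> complex) \<Rightarrow> bool" where
  "divides_disk_into_two_domains g \<longleftrightarrow> card (components (ball 0 1 - curve_in_disk g)) = 2"

text \<open>\<open>g\<close> traverses \<open>\<Gamma>\<close> as part of the positively oriented boundary of \<open>D\<close> when \<open>D\<close> lies
  to the left of \<open>g\<close>; the left normal at \<open>g s\<close> is \<open>\<i>\<close> times the tangent vector.\<close>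

definition positively_oriented_wrt :: "(real \<Rightarrow> complex) \<Rightarrow> complex set \<Rightarrow> bool" where
  "positively_oriented_wrt g D \<longleftrightarrow>
     (\<forall>s\<in>{0<..<1}. \<forall>\<^sub>F e in at_right 0.
        g s + of_real e * (\<i> * vector_derivative g (at s)) \<in> D)"

definition lune :: "(real \<Rightarrow> complex) \<Rightarrow> complex set \<Rightarrow> bool" where
  "lune g D \<longleftrightarrow>
     smooth_curve_in_disk g \<and>
     divides_disk_into_two_domains g \<and>
     D \<in> components (ball 0 1 - curve_in_disk g) \<and>
     0 \<notin> D \<and>
     positively_oriented_wrt g D"

text \<open>A smooth curve with end point the origin is an embedded regular C1 half-line
  starting at the origin.\<close>

definition smooth_curve_from_origin :: "(real \<Rightarrow> complex) \<Rightarrow> bool" where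
  "smooth_curve_from_origin \<gamma> \<longleftrightarrow>
     \<gamma> 0 = 0 \<and>
     \<gamma> C1_differentiable_on {0..} \<and>
     (\<forall>s\<ge>0. vector_derivative \<gamma> (at s) \<noteq> 0) \<and>
     (\<exists>h. homeomorphism {0..} (\<gamma> ` {0..}) \<gamma> h)"

text \<open>Transversality at the origin: wherever \<open>\<Gamma>\<close> passes through the origin, the two tangent
  vectors span the plane over the reals.  As usual for transversality, nothing is required
  if \<open>\<Gamma>\<close> avoids the origin.\<close>

definition transversal_at_origin :: "(real \<Rightarrow> complex) \<Rightarrow> (real \<Rightarrow> complex) \<Rightarrow> bool" where
  "transversal_at_origin g \<gamma> \<longleftrightarrow>
     (\<forall>s\<in>{0..1}. g s = 0 \<longrightarrow>
        span {vector_derivative g (at s), vector_derivative \<gamma> (at 0)} = UNIV)"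

end

theory Submission
  imports Defs
begin

text \<open>Let \<open>C\<close> be the Cauchy integral of \<open>u\<close> over \<open>\<Gamma>\<close> and \<open>h = C - u 1\<^sub>D\<close>. By the jump relation,
  \<open>h\<close> continues holomorphically across \<open>\<Gamma>\<close>; this is local, and follows from Cauchy's formula on
  a strip above a short piece of \<open>\<Gamma>\<close>. The end points of \<open>\<Gamma>\<close> (they lie in the disk if \<open>\<Gamma>\<close> is a
  closed curve) are removable singularities, because \<open>h\<close> is bounded there by
  \<open>const + const \<integral> 1 / \<bar>g s - w\<bar> ds\<close>. So \<open>h\<close> extends to a function \<open>H\<close> holomorphic in the
  whole disk.

  The kernel is \<open>1 / (\<zeta> - z)\<close> minus a geometric sum in \<open>(z - a) / (\<zeta> - a)\<close>, \<open>a = \<gamma> (t N)\<close>.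
  As \<open>a\<close> lies off \<open>\<Gamma> \<union> D\<close>, where \<open>H = C\<close>, the \<open>N\<close>-th integral equals
  \<open>u z\<close> plus the \<open>N\<close>-th Taylor remainder of \<open>H\<close> at \<open>a\<close>, evaluated at \<open>z\<close>. The remainder tends
  to \<open>0\<close> locally uniformly as \<open>a\<close> tends to the center of the disk, and no integral over the arc
  of the unit circle ever enters.\<close>

section \<open>Cauchy's formula on a curved strip\<close>

text \<open>A direct estimate of the integrand is out of reach: when \<Gamma> passes through the
  origin, \<open>\<zeta> - a\<close> has no lower bound on \<Gamma> uniform in N, so powers of
  \<open>(z - a) / (\<zeta> - a)\<close> blow up there. H does not depend on N and is holomorphic
  across \<Gamma>, so its Taylor series at a does not see \<Gamma>. Transversality enters
  qualitatively, to keep a off \<Gamma>; no angle is measured.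

  The boundary of D is controlled only along \<Gamma>, and u is merely continuous there. Cauchy's
  theorem is therefore applied to strips bounded by a piece of \<Gamma>, its translate in a fixed
  direction, and two segments. The orientation condition speaks of the left side of \<Gamma> only;
  that D stays off the right side is extracted from the count of two components.

  At an end point inside the disk no strip exists, and \<Gamma> may have a corner. Pointwise control
  of the Cauchy integral is replaced there by area averages, for which Tonelli's theorem and the
  integrability of \<open>1 / \<bar>z\<bar>\<close> in the plane suffice.\<close>

lemma Cauchy_type_integral_holomorphic:
  fixes \<phi> \<psi> :: "real \<Rightarrow> complex"
  assumes \<phi>: "continuous_on {a..b} \<phi>" and \<psi>: "continuous_on {a..b} \<psi>"
    and S: "open S" and avoid: "\<And>s. s \<in> {a..b} \<Longrightarrow> \<phi> s \<notin> S"
  shows "(\<lambda>w. integral {a..b} (\<lambda>s. \<psi> s / (\<phi> s - w))) holomorphic_on S"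
proof -
  have "\<exists>F. ((\<lambda>w. integral {a..b} (\<lambda>s. \<psi> s / (\<phi> s - w))) has_field_derivative F) (at w)"
    if w: "w \<in> S" for w
  proof -
    obtain r where r: "r > 0" "ball w r \<subseteq> S"
      using S w openE by blast
    have ne: "\<phi> s - x \<noteq> 0" if "s \<in> {a..b}" "x \<in> ball w r" for s x
      using that avoid r(2) by auto
    have "(\<lambda>w. integral (cbox a b) (\<lambda>s. \<psi> s / (\<phi> s - w))) holomorphic_on ball w r"
    proof (rule leibniz_rule_holomorphic[where fx = "\<lambda>w s. \<psi> s / (\<phi> s - w)^2"])
      show "((\<lambda>x. \<psi> t / (\<phi> t - x)) has_field_derivative \<psi> t / (\<phi> t - x)\<^sup>2) (at x within ball w r)"
        if "x \<in> ball w r" "t \<in> cbox a b" for x t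
        using ne[of t x] that
        by (auto intro!: derivative_eq_intros simp: power2_eq_square)
      show "(\<lambda>s. \<psi> s / (\<phi> s - x)) integrable_on cbox a b" if "x \<in> ball w r" for x
        unfolding cbox_interval
        by (rule integrable_continuous_real) (use that ne in \<open>auto intro!: continuous_intros \<phi> \<psi>\<close>)
      have "continuous_on (ball w r \<times> {a..b}) (\<lambda>p. \<psi> (snd p) / (\<phi> (snd p) - fst p)\<^sup>2)"
        by (intro continuous_intros continuous_on_compose2[OF \<phi>] continuous_on_compose2[OF \<psi>])
           (use ne in auto)
      then show "continuous_on (ball w r \<times> cbox a b) (\<lambda>(w, s). \<psi> s / (\<phi> s - w)\<^sup>2)"
        by (simp add: case_prod_unfold)
    qed auto
    then show ?thesis
      using r(1) holomorphic_on_open by (fastforce simp: holomorphic_on_open)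
  qed
  then show ?thesis
    using S by (simp add: holomorphic_on_open)
qed

text \<open>Differentiating the integral of \<open>f (g s + of_real e * v) * g' s\<close> in e
  leaves only boundary terms, which yield the two segments. f need not be holomorphic on the edges
  \<open>e = 0\<close> and \<open>e = b\<close>: continuity of the integral up to the edges is
  enough, so u qualifies with its mere continuity on \<Gamma>.\<close>

lemma strip_Cauchy:
  fixes f :: "complex \<Rightarrow> complex" and g g' :: "real \<Rightarrow> complex" and v :: complex
  assumes cd: "c \<le> d" and b: "0 < b"
    and g: "\<And>s. s \<in> {c..d} \<Longrightarrow> (g has_vector_derivative g' s) (at s within {c..d})"
    and g': "continuous_on {c..d} g'"
    and S: "open S" "f holomorphic_on S"
    and inS: "\<And>s e. s \<in> {c..d} \<Longrightarrow> e \<in> {0<..<b} \<Longrightarrow> g s + of_real e * v \<in> S"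
    and f: "continuous_on ((\<lambda>(s, e). g s + of_real e * v) ` ({c..d} \<times> {0..b})) f"
  shows "integral {c..d} (\<lambda>s. f (g s + of_real b * v) * g' s) - integral {c..d} (\<lambda>s. f (g s) * g' s)
       = integral {0..b} (\<lambda>e. v * (f (g d + of_real e * v) - f (g c + of_real e * v)))"
proof -
  have cg: "continuous_on {c..d} g"
    using g by (meson continuous_on_vector_derivative)
  have cfg: "continuous_on ({0..b} \<times> {c..d}) (\<lambda>p. f (g (snd p) + of_real (fst p) * v))"
    by (rule continuous_on_compose2[OF f])
       (auto intro!: continuous_intros continuous_on_compose2[OF cg])
  have cJ: "continuous_on {0..b} (\<lambda>e. integral (cbox c d) (\<lambda>s. f (g s + of_real e * v) * g' s))"
  proof (rule integral_continuous_on_param)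
    have "continuous_on ({0..b} \<times> {c..d}) (\<lambda>p. f (g (snd p) + of_real (fst p) * v) * g' (snd p))"
      by (intro continuous_intros cfg continuous_on_compose2[OF g']) auto
    then show "continuous_on ({0..b} \<times> cbox c d) (\<lambda>(e, s). f (g s + of_real e * v) * g' s)"
      by (simp add: case_prod_unfold)
  qed
  have df: "(f has_field_derivative deriv f z) (at z)" if "z \<in> S" for z
    using S that by (meson holomorphic_derivI)
  have cdf: "continuous_on S (deriv f)"
    using S holomorphic_deriv holomorphic_on_imp_continuous_on by blast
  have dJ: "((\<lambda>e. integral (cbox c d) (\<lambda>s. f (g s + of_real e * v) * g' s)) has_vector_derivative
      v * (f (g d + of_real e * v) - f (g c + of_real e * v))) (at e)" if e: "e \<in> {0<..<b}" for e
  proof -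
    have *: "((\<lambda>e. integral (cbox c d) (\<lambda>s. f (g s + of_real e * v) * g' s)) has_vector_derivative
      integral (cbox c d) (\<lambda>s. deriv f (g s + of_real e * v) * v * g' s)) (at e within {0<..<b})"
    proof (rule leibniz_rule_vector_derivative)
      fix x t assume x: "x \<in> {0<..<b}" and t: "t \<in> cbox c d"
      have "((\<lambda>x. g t + of_real x * v) has_vector_derivative v) (at x within {0<..<b})"
        by (auto intro!: derivative_eq_intros simp: has_vector_derivative_def scaleR_conv_of_real)
      then have "((f \<circ> (\<lambda>x. g t + of_real x * v)) has_vector_derivative v * deriv f (g t + of_real x * v))
          (at x within {0<..<b})"
        by (rule field_vector_diff_chain_within)
           (use df[OF inS] x t in \<open>auto intro: has_field_derivative_at_within\<close>)
      then show "((\<lambda>x. f (g t + of_real x * v) * g' t) has_vector_derivative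
          deriv f (g t + of_real x * v) * v * g' t) (at x within {0<..<b})"
        using has_vector_derivative_mult_left by (fastforce simp: o_def mult.commute)
    next
      fix x assume x: "x \<in> {0<..<b}"
      have "continuous_on {c..d} (\<lambda>s. (x, s))"
        by (intro continuous_intros)
      from continuous_on_compose2[OF cfg this] x
      have "continuous_on {c..d} (\<lambda>s. f (g s + of_real x * v))"
        by (simp add: image_subset_iff)
      then show "(\<lambda>s. f (g s + of_real x * v) * g' s) integrable_on cbox c d"
        unfolding cbox_interval by (intro integrable_continuous_real continuous_intros g')
    next
      have "continuous_on ({0<..<b} \<times> {c..d})
          (\<lambda>p. deriv f (g (snd p) + of_real (fst p) * v) * v * g' (snd p))"
        by (intro continuous_intros continuous_on_compose2[OF cdf] continuous_on_compose2[OF cg]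
              continuous_on_compose2[OF g']) (use inS in auto)
      then show "continuous_on ({0<..<b} \<times> cbox c d)
          (\<lambda>(x, t). deriv f (g t + of_real x * v) * v * g' t)"
        by (simp add: case_prod_unfold)
    qed (use e in auto)
    \<comment> \<open>Up to the factor v, the e-derivative of the integrand is an s-derivative, so
      it integrates to end point values.\<close>
    have "((\<lambda>s. v * (g' s * deriv f (g s + of_real e * v))) has_integral
        v * (f (g d + of_real e * v) - f (g c + of_real e * v))) {c..d}"
    proof (intro has_integral_mult_right fundamental_theorem_of_calculus cd)
      fix s assume s: "s \<in> {c..d}"
      have "((\<lambda>s. g s + of_real e * v) has_vector_derivative g' s) (at s within {c..d})"
        using g[OF s] by (auto intro!: derivative_eq_intros)
      then have "((f \<circ> (\<lambda>s. g s + of_real e * v)) has_vector_derivative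
          g' s * deriv f (g s + of_real e * v)) (at s within {c..d})"
        by (rule field_vector_diff_chain_within)
           (use df[OF inS] s e in \<open>auto intro: has_field_derivative_at_within\<close>)
      then show "((\<lambda>s. f (g s + of_real e * v)) has_vector_derivative
          g' s * deriv f (g s + of_real e * v)) (at s within {c..d})"
        by (simp add: o_def)
    qed
    moreover have "(\<lambda>s. v * (g' s * deriv f (g s + of_real e * v))) =
        (\<lambda>s. deriv f (g s + of_real e * v) * v * g' s)"
      by (rule ext) (simp only: mult_ac)
    ultimately have "integral (cbox c d) (\<lambda>s. deriv f (g s + of_real e * v) * v * g' s) =
        v * (f (g d + of_real e * v) - f (g c + of_real e * v))"
      by (simp only: cbox_interval integral_unique)
    with * show ?thesis
      using e by (simp only: at_within_open[OF e open_greaterThanLessThan])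
  qed
  have "((\<lambda>e. v * (f (g d + of_real e * v) - f (g c + of_real e * v))) has_integral
      integral (cbox c d) (\<lambda>s. f (g s + of_real b * v) * g' s) -
      integral (cbox c d) (\<lambda>s. f (g s + of_real 0 * v) * g' s)) {0..b}"
    using b by (intro fundamental_theorem_of_calculus_interior cJ dJ) auto
  from integral_unique[OF this] show ?thesis
    by (simp only: cbox_interval of_real_0 mult_zero_left add_0_right)
qed

text \<open>The two branches are cut along the positive and the negative imaginary axis
  respectively. Off that axis they differ by a constant on each half plane; the second claim is the
  left half plane, written with \<open>- z\<close>.\<close>

lemma Ln_ii_diff:
  assumes "Re z > 0"
  shows "Ln (\<i> * z) - Ln (- \<i> * z) = \<i> * of_real pi"
    and "Ln (\<i> * (- z)) - Ln (- \<i> * (- z)) = - \<i> * of_real pi"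
proof -
  have z: "z \<noteq> 0" using assms by auto
  have 1: "Ln (\<i> * z) = Ln z + \<i> * of_real pi/2"
    using Ln_times_ii[OF z] assms by simp
  have 2: "Ln (- (\<i> * z)) = Ln z - \<i> * of_real pi/2"
    using Ln_minus[of "\<i> * z"] z assms 1 Re_Ln_pos_lt[of z] by (auto simp: algebra_simps)
  have 3: "- \<i> * z = - (\<i> * z)" "\<i> * (- z) = - (\<i> * z)" "- \<i> * (- z) = \<i> * z"
    by auto
  show "Ln (\<i> * z) - Ln (- \<i> * z) = \<i> * of_real pi"
    "Ln (\<i> * (- z)) - Ln (- \<i> * (- z)) = - \<i> * of_real pi"
    unfolding 3 1 2 by (auto simp: field_simps)
qed

text \<open>Two logarithms are used, with cuts going up and down from \<open>w\<close> along the strip; their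
  difference jumps by \<open>2\<pi>\<i>\<close> between the two sides of \<open>w\<close>.\<close>

lemma strip_winding:
  fixes g g' :: "real \<Rightarrow> complex" and T w :: complex
  assumes cd: "c < d" and T: "T \<noteq> 0" and b: "0 < b"
    and g: "\<And>s. s \<in> {c..d} \<Longrightarrow> (g has_vector_derivative g' s) (at s within {c..d})"
    and mono: "strict_mono_on {c..d} (\<lambda>s. Re (g s / T))"
    and sw: "sw \<in> {c<..<d}" and ew: "ew \<in> {0<..<b}"
    and w: "w = g sw + of_real ew * (\<i> * T)"
  shows "integral {c..d} (\<lambda>s. 1 / (g s - w) * g' s)
       - integral {c..d} (\<lambda>s. 1 / (g s + of_real b * (\<i> * T) - w) * g' s)
       + integral {0..b} (\<lambda>e. \<i> * T * (1 / (g d + of_real e * (\<i> * T) - w)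
                                       - 1 / (g c + of_real e * (\<i> * T) - w))) = 2 * of_real pi * \<i>"
proof -
  define L1 where "L1 z = Ln (\<i> * (z / T))" for z
  define L2 where "L2 z = Ln (- \<i> * (z / T))" for z
  have log_int: "((\<lambda>s. 1 / p s * p' s) has_integral Ln (k * (p y / T)) - Ln (k * (p x / T))) {x..y}"
    if "x \<le> y" "k \<noteq> 0" "\<And>s. s \<in> {x..y} \<Longrightarrow> (p has_vector_derivative p' s) (at s within {x..y})"
      "\<And>s. s \<in> {x..y} \<Longrightarrow> k * (p s / T) \<notin> \<real>\<^sub>\<le>\<^sub>0" for p p' x y k
  proof (rule fundamental_theorem_of_calculus)
    fix s assume s: "s \<in> {x..y}"
    have "((\<lambda>z. Ln (k * (z / T))) has_field_derivative 1 / p s) (at (p s))"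
      using that(2) that(4)[OF s] T by (auto intro!: derivative_eq_intros simp: field_simps)
    then have "((\<lambda>z. Ln (k * (z / T))) \<circ> p has_vector_derivative p' s * (1 / p s)) (at s within {x..y})"
      using that(3)[OF s] field_vector_diff_chain_within has_field_derivative_at_within by blast
    then show "((\<lambda>s. Ln (k * (p s / T))) has_vector_derivative 1 / p s * p' s) (at s within {x..y})"
      by (simp add: o_def mult.commute)
  qed fact
  \<comment> \<open>By monotonicity only the parameter sw has the abscissa of w. There the lower
    edge lies below w and the upper edge above it, so neither edge meets the cut of its
    branch.\<close>
  have X: "Re (g s / T) = Re (g sw / T) \<longleftrightarrow> s = sw" if "s \<in> {c..d}" for s
    using mono that sw unfolding strict_mono_on_def
    by (metis greaterThanLessThan_iff atLeastAtMost_iff less_eq_real_def less_irrefl linorder_less_linear)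
  have wT: "w / T = g sw / T + of_real ew * \<i>"
    using T by (simp add: w field_simps)
  have Xd: "Re (g d / T) > Re (g sw / T)" and Xc: "Re (g c / T) < Re (g sw / T)"
    using mono sw cd unfolding strict_mono_on_def by auto
  have 1: "integral {c..d} (\<lambda>s. 1 / (g s - w) * g' s) = L1 (g d - w) - L1 (g c - w)"
    unfolding L1_def
  proof (intro integral_unique log_int)
    fix s assume s: "s \<in> {c..d}"
    show "((\<lambda>s. g s - w) has_vector_derivative g' s) (at s within {c..d})"
      using g[OF s] by (auto intro!: derivative_eq_intros)
    show "\<i> * ((g s - w) / T) \<notin> \<real>\<^sub>\<le>\<^sub>0"
      using X[OF s] ew by (auto simp: complex_nonpos_Reals_iff diff_divide_distrib wT)
  qed (use cd in auto)
  have 2: "integral {c..d} (\<lambda>s. 1 / (g s + of_real b * (\<i> * T) - w) * g' s) =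
      L2 (g d + of_real b * (\<i> * T) - w) - L2 (g c + of_real b * (\<i> * T) - w)"
    unfolding L2_def
  proof (intro integral_unique log_int)
    fix s assume s: "s \<in> {c..d}"
    show "((\<lambda>s. g s + of_real b * (\<i> * T) - w) has_vector_derivative g' s) (at s within {c..d})"
      using g[OF s] by (auto intro!: derivative_eq_intros)
    show "- \<i> * ((g s + of_real b * (\<i> * T) - w) / T) \<notin> \<real>\<^sub>\<le>\<^sub>0"
      using X[OF s] ew T by (auto simp: complex_nonpos_Reals_iff diff_divide_distrib add_divide_distrib wT)
  qed (use cd in auto)
  have vd: "((\<lambda>e. z + of_real e * (\<i> * T) - w) has_vector_derivative \<i> * T) (at e within {0..b})" for z e
    by (auto intro!: derivative_eq_intros simp: has_vector_derivative_def scaleR_conv_of_real)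
  have 3: "((\<lambda>e. 1 / (z + of_real e * (\<i> * T) - w) * (\<i> * T)) has_integral
      L2 (z + of_real b * (\<i> * T) - w) - L2 (z - w)) {0..b}"
    if z: "Re (z / T) \<noteq> Re (g sw / T)" for z
  proof -
    have "((\<lambda>e. 1 / (z + of_real e * (\<i> * T) - w) * (\<i> * T)) has_integral
      L2 (z + of_real b * (\<i> * T) - w) - L2 (z + of_real 0 * (\<i> * T) - w)) {0..b}"
      unfolding L2_def
    proof (intro log_int vd)
      fix e assume s: "e \<in> {0..b}"
      show "- \<i> * ((z + of_real e * (\<i> * T) - w) / T) \<notin> \<real>\<^sub>\<le>\<^sub>0"
        using z T by (auto simp: complex_nonpos_Reals_iff diff_divide_distrib add_divide_distrib wT)
    qed (use b in auto)
    then show ?thesis by simp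
  qed
  have 4: "integral {0..b} (\<lambda>e. \<i> * T * (1 / (g d + of_real e * (\<i> * T) - w)
                                       - 1 / (g c + of_real e * (\<i> * T) - w))) =
      (L2 (g d + of_real b * (\<i> * T) - w) - L2 (g d - w)) -
      (L2 (g c + of_real b * (\<i> * T) - w) - L2 (g c - w))"
    using has_integral_diff[OF 3[of "g d"] 3[of "g c"]] Xd Xc
    by (intro integral_unique) (simp add: algebra_simps)
  \<comment> \<open>The branch is switched at the two lower corners, with differences \<i>\<pi> at
    \<open>g d\<close> and -\<i>\<pi> at \<open>g c\<close>; these enter with opposite signs and
    give 2\<pi>\<i>.\<close>
  have "L1 (g d - w) - L2 (g d - w) = \<i> * of_real pi"
    unfolding L1_def L2_def using Xd by (intro Ln_ii_diff) (simp add: diff_divide_distrib wT)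
  moreover have "L1 (g c - w) - L2 (g c - w) = - \<i> * of_real pi"
    unfolding L1_def L2_def using Xc Ln_ii_diff(2)[of "- ((g c - w) / T)"]
    by (simp add: diff_divide_distrib wT)
  ultimately show ?thesis
    unfolding 1 2 4 by (simp add: algebra_simps)
qed

text \<open>The divided difference of u at w has a removable singularity, so
  \<open>strip_Cauchy\<close> applies to it; the remaining part \<open>u w / (z - w)\<close> is
  evaluated by \<open>strip_winding\<close>.\<close>

lemma strip_Cauchy_formula:
  fixes u :: "complex \<Rightarrow> complex" and g g' :: "real \<Rightarrow> complex" and T w :: complex
  assumes cd: "c < d" and b: "0 < b" and T: "T \<noteq> 0"
    and g: "\<And>s. s \<in> {c..d} \<Longrightarrow> (g has_vector_derivative g' s) (at s within {c..d})"
    and g': "continuous_on {c..d} g'"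
    and mono: "strict_mono_on {c..d} (\<lambda>s. Re (g s / T))"
    and S: "open S" "u holomorphic_on S"
    and inS: "\<And>s e. s \<in> {c..d} \<Longrightarrow> e \<in> {0<..<b} \<Longrightarrow> g s + of_real e * (\<i> * T) \<in> S"
    and u: "continuous_on ((\<lambda>(s, e). g s + of_real e * (\<i> * T)) ` ({c..d} \<times> {0..b})) u"
    and sw: "sw \<in> {c<..<d}" and ew: "ew \<in> {0<..<b}"
    and w: "w = g sw + of_real ew * (\<i> * T)"
  shows "integral {c..d} (\<lambda>s. u (g s) / (g s - w) * g' s)
       - integral {c..d} (\<lambda>s. u (g s + of_real b * (\<i> * T)) / (g s + of_real b * (\<i> * T) - w) * g' s)
       + integral {0..b} (\<lambda>e. \<i> * T * (u (g d + of_real e * (\<i> * T)) / (g d + of_real e * (\<i> * T) - w)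
                                       - u (g c + of_real e * (\<i> * T)) / (g c + of_real e * (\<i> * T) - w)))
       = 2 * of_real pi * \<i> * u w"
proof -
  define v where "v = \<i> * T"
  define K where "K = (\<lambda>(s, e). g s + of_real e * v) ` ({c..d} \<times> {0..b})"
  define F where "F z = (if z = w then deriv u w else u z / (z - w) - u w / (z - w))" for z
  have inK: "g s + of_real e * v \<in> K" if "s \<in> {c..d}" "e \<in> {0..b}" for s e
    using that unfolding K_def by force
  have wS: "w \<in> S"
    using inS[of sw ew] sw ew w by auto
  have FS: "F holomorphic_on S"
    unfolding F_def by (rule pole_theorem_open[OF S(2,1)]) auto
  have uK: "continuous_on K u"
    using u by (simp add: K_def v_def)
  have wK: "w \<in> K"
    using inK[of sw ew] sw ew w by (auto simp: v_def)
  \<comment> \<open>The edges of the strip may lie outside S, so holomorphy alone does not give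
    continuity on K; away from w the quotient formula does.\<close>
  have FK: "continuous_on K F"
  proof -
    have "continuous_on ((K - {w}) \<union> (K \<inter> S)) F"
    proof (rule continuous_on_Un_local_open)
      show "openin (top_of_set (K - {w} \<union> K \<inter> S)) (K - {w})"
        by (rule openin_open[THEN iffD2]) (use wS in \<open>auto intro!: exI[of _ "- {w}"]\<close>)
      show "openin (top_of_set (K - {w} \<union> K \<inter> S)) (K \<inter> S)"
        by (rule openin_open[THEN iffD2]) (use wS S in \<open>auto intro!: exI[of _ S]\<close>)
      show "continuous_on (K \<inter> S) F"
        using FS holomorphic_on_imp_continuous_on continuous_on_subset by blast
      have "continuous_on (K - {w}) (\<lambda>z. u z / (z - w) - u w / (z - w))"
        by (intro continuous_intros continuous_on_subset[OF uK]) auto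
      then show "continuous_on (K - {w}) F"
        by (rule continuous_on_eq) (auto simp: F_def)
    qed
    moreover have "K - {w} \<union> K \<inter> S = K"
      using wS by auto
    ultimately show ?thesis by simp
  qed
  have X: "Re (g s / T) = Re (g sw / T) \<longleftrightarrow> s = sw" if "s \<in> {c..d}" for s
    using mono that sw unfolding strict_mono_on_def
    by (metis greaterThanLessThan_iff atLeastAtMost_iff less_eq_real_def less_irrefl linorder_less_linear)
  have ne: "g s + of_real e * v \<noteq> w" if "s \<in> {c..d}" "s = c \<or> s = d \<or> e = 0 \<or> e = b" for s e
  proof
    assume eq: "g s + of_real e * v = w"
    then have "g s / T + of_real e * \<i> = g sw / T + of_real ew * \<i>"
      using T by (simp add: w v_def field_simps)
    then have "Re (g s / T) = Re (g sw / T)"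
      by (metis Re_i_times complex_Re_of_int add.commute add_left_cancel minus_zero mult.commute
          plus_complex.simps(1) Im_complex_of_real add_0_right)
    then have "s = sw"
      using X that by blast
    then show False
      using eq T that sw ew by (auto simp: w v_def)
  qed
  have cg: "continuous_on {c..d} g"
    using g by (meson continuous_on_vector_derivative)
  have hor: "integral {c..d} (\<lambda>s. F (g s + of_real e * v) * g' s) =
      integral {c..d} (\<lambda>s. u (g s + of_real e * v) / (g s + of_real e * v - w) * g' s) -
      u w * integral {c..d} (\<lambda>s. 1 / (g s + of_real e * v - w) * g' s)"
    if e: "e = 0 \<or> e = b" for e
  proof -
    have cue: "continuous_on {c..d} (\<lambda>s. u (g s + of_real e * v))"
      by (rule continuous_on_compose2[OF uK]) (use inK[of _ e] e b in \<open>auto intro!: continuous_intros cg\<close>)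
    have "integral {c..d} (\<lambda>s. F (g s + of_real e * v) * g' s) =
      integral {c..d} (\<lambda>s. u (g s + of_real e * v) / (g s + of_real e * v - w) * g' s -
        u w * (1 / (g s + of_real e * v - w) * g' s))"
      by (intro integral_cong) (use ne e in \<open>auto simp: F_def field_simps\<close>)
    also have "\<dots> = integral {c..d} (\<lambda>s. u (g s + of_real e * v) / (g s + of_real e * v - w) * g' s) -
      integral {c..d} (\<lambda>s. u w * (1 / (g s + of_real e * v - w) * g' s))"
      by (intro integral_diff integrable_continuous_real continuous_intros cue cg g') (use ne e in auto)
    finally show ?thesis
      by (simp only: integral_mult_right)
  qed
  have cside: "continuous_on {0..b} (\<lambda>e. u (g s + of_real e * v))" if "s = c \<or> s = d" for s
    by (rule continuous_on_compose2[OF uK]) (use inK that cd in \<open>auto intro!: continuous_intros\<close>)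
  have side: "integral {0..b} (\<lambda>e. v * (F (g d + of_real e * v) - F (g c + of_real e * v))) =
      integral {0..b} (\<lambda>e. v * (u (g d + of_real e * v) / (g d + of_real e * v - w)
                                       - u (g c + of_real e * v) / (g c + of_real e * v - w))) -
      u w * integral {0..b} (\<lambda>e. v * (1 / (g d + of_real e * v - w) - 1 / (g c + of_real e * v - w)))"
  proof -
    have "integral {0..b} (\<lambda>e. v * (F (g d + of_real e * v) - F (g c + of_real e * v))) =
      integral {0..b} (\<lambda>e. v * (u (g d + of_real e * v) / (g d + of_real e * v - w)
                                       - u (g c + of_real e * v) / (g c + of_real e * v - w)) -
      u w * (v * (1 / (g d + of_real e * v - w) - 1 / (g c + of_real e * v - w))))"
      by (intro integral_cong) (use ne cd in \<open>auto simp: F_def algebra_simps\<close>)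
    also have "\<dots> = integral {0..b} (\<lambda>e. v * (u (g d + of_real e * v) / (g d + of_real e * v - w)
                                       - u (g c + of_real e * v) / (g c + of_real e * v - w))) -
      integral {0..b} (\<lambda>e. u w * (v * (1 / (g d + of_real e * v - w) - 1 / (g c + of_real e * v - w))))"
      by (intro integral_diff integrable_continuous_real continuous_intros cside) (use ne cd in auto)
    finally show ?thesis
      by (simp only: integral_mult_right)
  qed
  have 1: "integral {c..d} (\<lambda>s. F (g s + of_real b * v) * g' s) - integral {c..d} (\<lambda>s. F (g s) * g' s)
       = integral {0..b} (\<lambda>e. v * (F (g d + of_real e * v) - F (g c + of_real e * v)))"
    by (rule strip_Cauchy[OF less_imp_le[OF cd] b g g' S(1) FS])
       (use inS FK in \<open>auto simp: K_def v_def\<close>)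
  have 2: "integral {c..d} (\<lambda>s. 1 / (g s - w) * g' s)
       - integral {c..d} (\<lambda>s. 1 / (g s + of_real b * v - w) * g' s)
       + integral {0..b} (\<lambda>e. v * (1 / (g d + of_real e * v - w)
                                       - 1 / (g c + of_real e * v - w))) = 2 * of_real pi * \<i>"
    unfolding v_def by (rule strip_winding[OF cd T b g mono sw ew w])
  have 3: "(A - U * A') - (B - U * B') = C - U * C' \<Longrightarrow> B' - A' + C' = P \<Longrightarrow> B - A + C = P * U"
    for A B C A' B' C' U P :: complex
    by algebra
  show ?thesis
    using 3[OF 1[unfolded side hor[OF disjI2[OF refl]]
        hor[OF disjI1[OF refl], unfolded of_real_0 mult_zero_left add_0_right]] 2]
    by (simp only: v_def)
qed

section \<open>Singularities bounded by a Cauchy integral\<close>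

text \<open>Estimates from here on take values in ennreal: Tonelli then applies without
  integrability conditions, and infinite values of the kernel do no harm.\<close>

lemma ennreal_norm_integral_le:
  fixes f :: "real \<Rightarrow> complex"
  assumes "continuous_on {a..b} f"
  shows "ennreal (norm (integral {a..b} f)) \<le> (\<integral>\<^sup>+s. ennreal (norm (f s)) * indicator {a..b} s \<partial>lborel)"
proof -
  have si: "set_integrable lborel {a..b} f"
    using assms by (rule borel_integrable_atLeastAtMost')
  have "ennreal (norm (LINT x:{a..b}|lborel. f x)) \<le>
      (\<integral>\<^sup>+s. norm (indicator {a..b} s *\<^sub>R f s) \<partial>lborel)"
    unfolding set_lebesgue_integral_def
    using si by (intro integral_norm_bound_ennreal) (simp add: set_integrable_def)
  also have "\<dots> = (\<integral>\<^sup>+s. ennreal (norm (f s)) * indicator {a..b} s \<partial>lborel)"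
    by (intro nn_integral_cong) (simp split: split_indicator)
  finally show ?thesis
    by (simp add: set_borel_integral_eq_integral(2)[OF si])
qed

text \<open>The constants are far from optimal; only the homogeneity in \<open>a\<close> matters.\<close>

lemma submean_square:
  fixes H :: "complex \<Rightarrow> complex"
  assumes S: "open S" "H holomorphic_on S" and a: "0 < a"
    and inS: "\<And>x y. \<bar>x\<bar> \<le> a \<Longrightarrow> \<bar>y\<bar> \<le> a \<Longrightarrow> w0 + Complex x y \<in> S"
  shows "ennreal (a\<^sup>2 * norm (H w0)) \<le>
    4 * (\<integral>\<^sup>+p. ennreal (norm (H (w0 + Complex (fst p) (snd p)))) *
          indicator ({-a..a} \<times> {-a..a}) p \<partial>lborel)"
proof -
  define \<phi> where "\<phi> p = ennreal (norm (indicator ({-a..a} \<times> {-a..a}) p *\<^sub>R H (w0 + Complex (fst p) (snd p))))" for p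
  have CH: "continuous_on S H"
    using S holomorphic_on_imp_continuous_on by blast
  have [continuous_intros]: "continuous_on A (\<lambda>x. Complex (f x) (h x))"
    if "continuous_on A f" "continuous_on A h" for A and f h :: "'z::topological_space \<Rightarrow> real"
    using that by (auto simp: Complex_eq intro!: continuous_intros)
  have [measurable]: "\<phi> \<in> borel_measurable (lborel \<Otimes>\<^sub>M lborel)"
  proof -
    have "(\<lambda>p. indicator ({-a..a} \<times> {-a..a}) p *\<^sub>R H (w0 + Complex (fst p) (snd p))) \<in> borel_measurable borel"
      by (intro borel_measurable_continuous_on_indicator continuous_on_compose2[OF CH] continuous_intros)
         (use inS in \<open>auto intro!: borel_closed closed_Times\<close>)
    then have "\<phi> \<in> borel_measurable borel"
      unfolding \<phi>_def by measurable
    then show ?thesis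
      by (simp add: lborel_prod)
  qed
  define G1 where "G1 x = (\<integral>\<^sup>+y. \<phi> (x, y) \<partial>lborel)" for x
  define G2 where "G2 y = (\<integral>\<^sup>+x. \<phi> (x, y) \<partial>lborel)" for y
  have [measurable]: "G1 \<in> borel_measurable borel" "G2 \<in> borel_measurable borel"
    unfolding G1_def G2_def by measurable
  \<comment> \<open>Cauchy's formula on the square of half-side r, regarded as a straight strip with
    \<open>T = 1\<close> and bottom edge at height -r. On its boundary the distance to w0 is at
    least \<open>a/2\<close>, which turns \<open>2 * pi\<close> into \<open>pi * a\<close>.\<close>
  have key: "ennreal (pi * a * norm (H w0)) \<le> G2 (-r) + G2 r + G1 r + G1 (-r)"
    if r: "r \<in> {a/2..a}" for r
  proof -
    define gg where "gg s = w0 + Complex s (-r)" for s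
    have r0: "0 < r" "r \<le> a" using r a by auto
    have gr: "gg s + of_real e * (\<i> * 1) = w0 + Complex s (e - r)" for s e
      by (simp add: gg_def complex_eq_iff)
    have formula: "integral {-r..r} (\<lambda>s. H (gg s) / (gg s - w0) * 1)
       - integral {-r..r} (\<lambda>s. H (gg s + of_real (2*r) * (\<i> * 1)) / (gg s + of_real (2*r) * (\<i> * 1) - w0) * 1)
       + integral {0..2*r} (\<lambda>e. \<i> * 1 * (H (gg r + of_real e * (\<i> * 1)) / (gg r + of_real e * (\<i> * 1) - w0)
                              - H (gg (-r) + of_real e * (\<i> * 1)) / (gg (-r) + of_real e * (\<i> * 1) - w0)))
       = 2 * of_real pi * \<i> * H w0"
    proof (rule strip_Cauchy_formula[where sw = 0 and ew = r])
      show "(gg has_vector_derivative 1) (at s within {-r..r})" for s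
        unfolding gg_def by (auto simp: Complex_eq has_vector_derivative_def scaleR_conv_of_real intro!: derivative_eq_intros)
      show "strict_mono_on {- r..r} (\<lambda>s. Re (gg s / 1))"
        by (auto simp: strict_mono_on_def gg_def)
      show "gg s + complex_of_real e * (\<i> * 1) \<in> S" if "s \<in> {-r..r}" "e \<in> {0<..<2*r}" for s e
        unfolding gr using that r0 by (intro inS) auto
      have "(\<lambda>(s, e). gg s + complex_of_real e * (\<i> * 1)) ` ({- r..r} \<times> {0..2 * r}) \<subseteq> S"
        unfolding gr using r0 by (auto intro!: inS)
      then show "continuous_on ((\<lambda>(s, e). gg s + complex_of_real e * (\<i> * 1)) ` ({- r..r} \<times> {0..2 * r})) H"
        using CH continuous_on_subset by blast
    qed (use r0 S in \<open>auto simp: gg_def complex_eq_iff\<close>)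
    have hor: "ennreal (norm (integral {-r..r} (\<lambda>s. H (w0 + Complex s y) / Complex s y))) \<le> ennreal (2/a) * G2 y"
      if y: "\<bar>y\<bar> = r" for y
    proof -
      have "ennreal (norm (integral {-r..r} (\<lambda>s. H (w0 + Complex s y) / Complex s y))) \<le>
          (\<integral>\<^sup>+s. ennreal (norm (H (w0 + Complex s y) / Complex s y)) * indicator {-r..r} s \<partial>lborel)"
        by (intro ennreal_norm_integral_le continuous_intros continuous_on_compose2[OF CH])
           (use inS r0 y in \<open>auto simp: complex_eq_iff\<close>)
      also have "\<dots> \<le> (\<integral>\<^sup>+s. ennreal (2/a) * \<phi> (s, y) \<partial>lborel)"
      proof (intro nn_integral_mono)
        fix s
        have "norm (Complex s y) \<ge> a/2"
          using abs_Im_le_cmod[of "Complex s y"] y r by auto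
        then have "norm (H (w0 + Complex s y)) / norm (Complex s y) \<le> norm (H (w0 + Complex s y)) / (a/2)"
          using a by (intro divide_left_mono mult_pos_pos) auto
        then show "ennreal (norm (H (w0 + Complex s y) / Complex s y)) * indicator {-r..r} s \<le> ennreal (2/a) * \<phi> (s, y)"
          using y r0 a by (auto simp: \<phi>_def norm_divide ennreal_mult[symmetric] field_simps split: split_indicator)
      qed
      also have "\<dots> = ennreal (2/a) * G2 y"
        unfolding G2_def by (intro nn_integral_cmult) measurable
      finally show ?thesis .
    qed
    have ver: "ennreal (norm (integral {0..2*r} (\<lambda>e. \<i> * (H (w0 + Complex r (e - r)) / Complex r (e - r) -
         H (w0 + Complex (-r) (e - r)) / Complex (-r) (e - r))))) \<le> ennreal (2/a) * (G1 r + G1 (-r))"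
    proof -
      have "ennreal (norm (integral {0..2*r} (\<lambda>e. \<i> * (H (w0 + Complex r (e - r)) / Complex r (e - r) -
         H (w0 + Complex (-r) (e - r)) / Complex (-r) (e - r))))) \<le>
          (\<integral>\<^sup>+e. ennreal (norm (\<i> * (H (w0 + Complex r (e - r)) / Complex r (e - r) -
         H (w0 + Complex (-r) (e - r)) / Complex (-r) (e - r)))) * indicator {0..2*r} e \<partial>lborel)"
        by (intro ennreal_norm_integral_le continuous_intros continuous_on_compose2[OF CH])
           (use inS r0 in \<open>auto simp: complex_eq_iff\<close>)
      also have "\<dots> \<le> (\<integral>\<^sup>+e. ennreal (2/a) * (\<phi> (r, -r + 1 * e) + \<phi> (-r, -r + 1 * e)) \<partial>lborel)"
      proof (intro nn_integral_mono)
        fix e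
        have *: "norm (H (w0 + Complex x (e - r)) / Complex x (e - r)) \<le> norm (H (w0 + Complex x (e - r))) * (2/a)"
          if x: "\<bar>x\<bar> = r" for x
        proof -
          have "norm (Complex x (e - r)) \<ge> a/2"
            using abs_Re_le_cmod[of "Complex x (e - r)"] x r by auto
          then have "norm (H (w0 + Complex x (e - r))) / norm (Complex x (e - r)) \<le> norm (H (w0 + Complex x (e - r))) / (a/2)"
            using a by (intro divide_left_mono mult_pos_pos) auto
          then show ?thesis by (simp add: norm_divide)
        qed
        have "norm (\<i> * (H (w0 + Complex r (e - r)) / Complex r (e - r) -
           H (w0 + Complex (-r) (e - r)) / Complex (-r) (e - r))) \<le>
           norm (H (w0 + Complex r (e - r)) / Complex r (e - r)) +
           norm (H (w0 + Complex (-r) (e - r)) / Complex (-r) (e - r))"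
          by (simp only: norm_mult norm_ii mult_1 norm_triangle_ineq4)
        also have "\<dots> \<le> 2/a * (norm (H (w0 + Complex r (e - r))) + norm (H (w0 + Complex (-r) (e - r))))"
          using *[of r] *[of "-r"] r0 by (auto simp: distrib_left mult.commute)
        finally show "ennreal (norm (\<i> * (H (w0 + Complex r (e - r)) / Complex r (e - r) -
           H (w0 + Complex (-r) (e - r)) / Complex (-r) (e - r)))) * indicator {0..2*r} e \<le>
           ennreal (2/a) * (\<phi> (r, -r + 1 * e) + \<phi> (-r, -r + 1 * e))"
          using r0 a
          by (auto simp: \<phi>_def ennreal_mult[symmetric] ennreal_plus[symmetric] simp del: ennreal_plus split: split_indicator)
      qed
      also have "\<dots> = ennreal (2/a) * ((\<integral>\<^sup>+e. \<phi> (r, -r + 1 * e) \<partial>lborel) + (\<integral>\<^sup>+e. \<phi> (-r, -r + 1 * e) \<partial>lborel))"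
        by (subst nn_integral_cmult, measurable) (subst nn_integral_add, measurable)
      also have "\<dots> = ennreal (2/a) * (G1 r + G1 (-r))"
        unfolding G1_def
        using nn_integral_real_affine[of "\<lambda>y. \<phi> (r, y)" 1 "-r"] nn_integral_real_affine[of "\<lambda>y. \<phi> (-r, y)" 1 "-r"]
        by simp
      finally show ?thesis .
    qed
    have "2 * of_real pi * \<i> * H w0 =
        integral {-r..r} (\<lambda>s. H (w0 + Complex s (-r)) / Complex s (-r))
        - integral {-r..r} (\<lambda>s. H (w0 + Complex s r) / Complex s r)
        + integral {0..2*r} (\<lambda>e. \<i> * (H (w0 + Complex r (e - r)) / Complex r (e - r) -
         H (w0 + Complex (-r) (e - r)) / Complex (-r) (e - r)))"
      unfolding formula[symmetric] gr
      by (simp add: gg_def)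
    moreover have "norm (A - B + C) \<le> norm A + norm B + norm C" for A B C :: complex
      using norm_triangle_ineq[of "A - B" C] norm_triangle_ineq4[of A B] by linarith
    ultimately have "norm (2 * of_real pi * \<i> * H w0) \<le>
        norm (integral {-r..r} (\<lambda>s. H (w0 + Complex s (-r)) / Complex s (-r)))
        + norm (integral {-r..r} (\<lambda>s. H (w0 + Complex s r) / Complex s r))
        + norm (integral {0..2*r} (\<lambda>e. \<i> * (H (w0 + Complex r (e - r)) / Complex r (e - r) -
         H (w0 + Complex (-r) (e - r)) / Complex (-r) (e - r))))"
      by (simp only:)
    then have "ennreal (norm (2 * of_real pi * \<i> * H w0)) \<le>
        ennreal (norm (integral {-r..r} (\<lambda>s. H (w0 + Complex s (-r)) / Complex s (-r))))
        + ennreal (norm (integral {-r..r} (\<lambda>s. H (w0 + Complex s r) / Complex s r)))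
        + ennreal (norm (integral {0..2*r} (\<lambda>e. \<i> * (H (w0 + Complex r (e - r)) / Complex r (e - r) -
         H (w0 + Complex (-r) (e - r)) / Complex (-r) (e - r)))))"
      by (simp add: ennreal_plus[symmetric] del: ennreal_plus)
    also have "\<dots> \<le> ennreal (2/a) * G2 (-r) + ennreal (2/a) * G2 r + ennreal (2/a) * (G1 r + G1 (-r))"
      by (intro add_mono hor ver) (use r0 in auto)
    also have "\<dots> = ennreal (2/a) * (G2 (-r) + G2 r + G1 r + G1 (-r))"
      by (simp add: distrib_left add.assoc)
    finally have "ennreal (a/2) * ennreal (norm (2 * of_real pi * \<i> * H w0)) \<le>
        ennreal (a/2) * (ennreal (2/a) * (G2 (-r) + G2 r + G1 r + G1 (-r)))"
      by (rule mult_left_mono) auto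
    also have "\<dots> = G2 (-r) + G2 r + G1 r + G1 (-r)"
      using a by (simp add: mult.assoc[symmetric] ennreal_mult[symmetric])
    finally show ?thesis
      using a by (simp add: ennreal_mult[symmetric] norm_mult mult_ac)
  qed
  have total: "(\<integral>\<^sup>+x. G1 x \<partial>lborel) = (\<integral>\<^sup>+p. \<phi> p \<partial>lborel)" "(\<integral>\<^sup>+y. G2 y \<partial>lborel) = (\<integral>\<^sup>+p. \<phi> p \<partial>lborel)"
    unfolding G1_def G2_def
    by (subst lborel.nn_integral_fst, measurable, simp add: lborel_prod)
       (subst lborel_pair.nn_integral_snd, measurable, simp add: lborel_prod)
  \<comment> \<open>Averaging over r in \<open>{a/2..a}\<close>: each of the four sides sweeps out
    at most the full square, whence the factor 4. The interval has length \<open>a/2\<close>, and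
    \<open>pi / 2 \<ge> 1\<close> absorbs the rest.\<close>
  have "ennreal (a/2 * (pi * a * norm (H w0))) = ennreal (pi * a * norm (H w0)) * emeasure lborel {a/2..a}"
    using a by (simp add: ennreal_mult[symmetric] mult_ac)
  also have "\<dots> = (\<integral>\<^sup>+r. ennreal (pi * a * norm (H w0)) * indicator {a/2..a} r \<partial>lborel)"
    by (simp add: nn_integral_cmult_indicator)
  also have "\<dots> \<le> (\<integral>\<^sup>+r. G2 (0 + (-1) * r) + G2 r + G1 r + G1 (0 + (-1) * r) \<partial>lborel)"
    by (intro nn_integral_mono) (use key in \<open>auto split: split_indicator\<close>)
  also have "\<dots> = (\<integral>\<^sup>+r. G2 (0 + (-1) * r) \<partial>lborel) + (\<integral>\<^sup>+r. G2 r \<partial>lborel) + (\<integral>\<^sup>+r. G1 r \<partial>lborel) + (\<integral>\<^sup>+r. G1 (0 + (-1) * r) \<partial>lborel)"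
    by (subst nn_integral_add; measurable?)+
  also have "\<dots> = 4 * (\<integral>\<^sup>+p. \<phi> p \<partial>lborel)"
  proof -
    have "(\<integral>\<^sup>+r. G1 (0 + (-1) * r) \<partial>lborel) = (\<integral>\<^sup>+p. \<phi> p \<partial>lborel)"
      "(\<integral>\<^sup>+r. G2 (0 + (-1) * r) \<partial>lborel) = (\<integral>\<^sup>+p. \<phi> p \<partial>lborel)"
      using nn_integral_real_affine[of G1 "-1" 0] nn_integral_real_affine[of G2 "-1" 0] total by simp_all
    moreover have "X + X + X + X = 4 * X" for X :: ennreal
    proof -
      have "(4::ennreal) = 1 + 1 + 1 + 1" by simp
      then show ?thesis by (simp only: distrib_right mult_1)
    qed
    ultimately show ?thesis
      by (simp only: total)
  qed
  finally have "ennreal (a/2 * (pi * a * norm (H w0))) \<le> 4 * (\<integral>\<^sup>+p. \<phi> p \<partial>lborel)" .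
  moreover have "a\<^sup>2 * norm (H w0) \<le> a/2 * (pi * a * norm (H w0))"
  proof -
    have "2 * (a * (a * norm (H w0))) \<le> pi * (a * (a * norm (H w0)))"
      using pi_ge_two a by (intro mult_right_mono) auto
    then show ?thesis
      by (simp add: power2_eq_square mult_ac)
  qed
  moreover have "(\<integral>\<^sup>+p. \<phi> p \<partial>lborel) = (\<integral>\<^sup>+p. ennreal (norm (H (w0 + Complex (fst p) (snd p)))) *
          indicator ({-a..a} \<times> {-a..a}) p \<partial>lborel)"
    by (intro nn_integral_cong) (auto simp: \<phi>_def split: split_indicator)
  ultimately show ?thesis
    by (metis ennreal_leI order_trans)
qed

text \<open>The real square root is odd in HOL, so \<open>2 * sqrt (x - \<xi>)\<close> is one
  continuous antiderivative on both sides of \<xi>. The bound does not depend on \<xi>, which later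
  is a coordinate of an arbitrary point.\<close>

lemma nn_integral_inverse_sqrt_le:
  assumes a: "0 < a"
  shows "(\<integral>\<^sup>+x. inverse (ennreal (sqrt \<bar>x - \<xi>\<bar>)) * indicator {-a..a} x \<partial>lborel) \<le> ennreal (4 * sqrt (2 * a))"
proof -
  define I where "I = 2 * sqrt (a - \<xi>) - 2 * sqrt (- a - \<xi>)"
  have "((\<lambda>x. inverse (sqrt \<bar>x - \<xi>\<bar>)) has_integral I) {-a..a}"
    unfolding I_def
  proof (rule fundamental_theorem_of_calculus_interior_strong[where S = "{\<xi>}"])
    fix x assume x: "x \<in> {- a<..<a} - {\<xi>}"
    have "(sqrt has_field_derivative inverse (sqrt \<bar>x - \<xi>\<bar>) / 2) (at (x - \<xi>))"
      by (rule DERIV_real_sqrt_generic) (use x real_sqrt_minus[of "x - \<xi>"] in auto)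
    then have "((\<lambda>x. sqrt (x - \<xi>)) has_field_derivative inverse (sqrt \<bar>x - \<xi>\<bar>) / 2 * 1) (at x)"
      by (rule DERIV_chain2) (auto intro!: derivative_eq_intros)
    from DERIV_cmult[OF this, of 2]
    have "((\<lambda>x. 2 * sqrt (x - \<xi>)) has_field_derivative inverse (sqrt \<bar>x - \<xi>\<bar>)) (at x)"
      by simp
    then show "((\<lambda>x. 2 * sqrt (x - \<xi>)) has_vector_derivative inverse (sqrt \<bar>x - \<xi>\<bar>)) (at x)"
      by (simp add: has_real_derivative_iff_has_vector_derivative)
  qed (use a in \<open>auto intro!: continuous_intros\<close>)
  then have I: "((\<lambda>x. inverse (sqrt \<bar>x - \<xi>\<bar>) * indicator {-a..a} x) has_integral I) UNIV"
    by (subst (asm) has_integral_restrict_UNIV[symmetric])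
       (auto elim!: has_integral_eq[rotated] simp: indicator_def)
  have "(\<integral>\<^sup>+x. inverse (ennreal (sqrt \<bar>x - \<xi>\<bar>)) * indicator {-a..a} x \<partial>lborel) =
      (\<integral>\<^sup>+x. ennreal (inverse (sqrt \<bar>x - \<xi>\<bar>) * indicator {-a..a} x) \<partial>lborel)"
    by (intro nn_integral_cong_AE eventually_mono[OF AE_lborel_singleton[of \<xi>]])
       (auto simp: inverse_ennreal split: split_indicator)
  also have "\<dots> = ennreal I"
    by (rule nn_integral_has_integral_lborel[OF _ _ I]) (auto intro!: mult_nonneg_nonneg)
  also have "I \<le> 4 * sqrt (2 * a)"
  proof -
    have tri: "sqrt (x + y) \<le> sqrt x + sqrt y" if "0 \<le> x" "0 \<le> y" for x y :: real
      using that sqrt_add_le_add_sqrt by blast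
    have s0: "0 \<le> sqrt (2 * a)"
      using a by simp
    have e: "- a - \<xi> + 2 * a = a - \<xi>" "\<xi> - a + 2 * a = a + \<xi>" by simp_all
    \<comment> \<open>Outside the interval subadditivity of sqrt gives \<open>sqrt (2 * a)\<close>;
      inside, two such terms add up, which is the source of the constant 4.\<close>
    consider "\<xi> < -a" | "\<xi> \<in> {-a..a}" | "a < \<xi>" by force
    then have "sqrt (a - \<xi>) - sqrt (- a - \<xi>) \<le> 2 * sqrt (2 * a)"
    proof cases
      case 1
      then show ?thesis
        using tri[of "- a - \<xi>" "2 * a", unfolded e] a s0 by linarith
    next
      case 2
      have "sqrt (a - \<xi>) \<le> sqrt (2 * a)" "sqrt (a + \<xi>) \<le> sqrt (2 * a)"
        using 2 by auto
      moreover have "sqrt (- a - \<xi>) = - sqrt (a + \<xi>)"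
        using real_sqrt_minus[of "a + \<xi>"] by simp
      ultimately show ?thesis by linarith
    next
      case 3
      have "sqrt (- a - \<xi>) = - sqrt (a + \<xi>)" "sqrt (a - \<xi>) = - sqrt (\<xi> - a)"
        using real_sqrt_minus[of "a + \<xi>"] real_sqrt_minus[of "\<xi> - a"] by simp_all
      then show ?thesis
        using tri[of "\<xi> - a" "2 * a", unfolded e] a 3 s0 by linarith
    qed
    then show ?thesis by (simp add: I_def)
  qed
  finally show ?thesis by (simp add: ennreal_leI)
qed

text \<open>\<open>norm z \<ge> sqrt \<bar>Re z\<bar> * sqrt \<bar>Im z\<bar>\<close>, so the kernel
  is dominated by a product of one-variable kernels, and Tonelli replaces polar coordinates. The
  constant is the square of \<open>4 * sqrt (2 * a)\<close>.\<close>

lemma nn_integral_inverse_norm_le: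
  assumes a: "0 < a"
  shows "(\<integral>\<^sup>+p. inverse (ennreal (norm (z - Complex (fst p) (snd p)))) *
          indicator ({-a..a} \<times> {-a..a}) p \<partial>lborel) \<le> ennreal (32 * a)"
proof -
  define k where "k \<xi> x = inverse (ennreal (sqrt \<bar>x - \<xi>\<bar>)) * indicator {-a..a} x" for \<xi> x :: real
  have [measurable]: "k \<xi> \<in> borel_measurable borel" for \<xi>
    unfolding k_def by measurable
  have prod: "inverse (ennreal (norm z)) \<le> inverse (ennreal (sqrt \<bar>Re z\<bar>)) * inverse (ennreal (sqrt \<bar>Im z\<bar>))" for z
  proof (cases "Re z = 0 \<or> Im z = 0")
    \<comment> \<open>On the axes one factor is the inverse of 0, which is infinite in ennreal, and
      the other factor is nonzero; the bound is trivial.\<close>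
    case True
    then have "inverse (ennreal (sqrt \<bar>Re z\<bar>)) * inverse (ennreal (sqrt \<bar>Im z\<bar>)) = \<infinity>"
      by (auto simp: ennreal_mult_top ennreal_top_mult)
    then show ?thesis by simp
  next
    case False
    have "sqrt \<bar>Re z\<bar> * sqrt \<bar>Im z\<bar> = sqrt (\<bar>Re z\<bar> * \<bar>Im z\<bar>)"
      by (simp add: real_sqrt_mult)
    also have "\<dots> \<le> sqrt (norm z * norm z)"
      by (intro real_sqrt_le_mono mult_mono abs_Re_le_cmod abs_Im_le_cmod) auto
    finally have "sqrt \<bar>Re z\<bar> * sqrt \<bar>Im z\<bar> \<le> norm z" by simp
    moreover have "sqrt \<bar>Re z\<bar> * sqrt \<bar>Im z\<bar> > 0"
      using False by simp
    ultimately have "inverse (norm z) \<le> inverse (sqrt \<bar>Re z\<bar>) * inverse (sqrt \<bar>Im z\<bar>)"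
      by (metis inverse_mult_distrib le_imp_inverse_le)
    moreover have "z \<noteq> 0" using False by auto
    ultimately show ?thesis
      using False by (simp add: inverse_ennreal ennreal_mult[symmetric])
  qed
  have "(\<integral>\<^sup>+p. inverse (ennreal (norm (z - Complex (fst p) (snd p)))) *
          indicator ({-a..a} \<times> {-a..a}) p \<partial>lborel) \<le> (\<integral>\<^sup>+p. k (Re z) (fst p) * k (Im z) (snd p) \<partial>lborel)"
    using prod[of "z - Complex _ _"]
    by (intro nn_integral_mono) (auto simp: k_def abs_minus_commute split: split_indicator)
  also have "\<dots> = (\<integral>\<^sup>+x. \<integral>\<^sup>+y. k (Re z) x * k (Im z) y \<partial>lborel \<partial>lborel)"
    unfolding lborel_prod[symmetric] by (subst lborel.nn_integral_fst[symmetric]) auto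
  also have "\<dots> = (\<integral>\<^sup>+x. k (Re z) x \<partial>lborel) * (\<integral>\<^sup>+y. k (Im z) y \<partial>lborel)"
    by (simp add: nn_integral_cmult nn_integral_multc)
  also have "\<dots> \<le> ennreal (4 * sqrt (2 * a)) * ennreal (4 * sqrt (2 * a))"
    unfolding k_def by (intro mult_mono nn_integral_inverse_sqrt_le a) auto
  also have "\<dots> = ennreal (32 * a)"
    using a by (simp add: ennreal_mult[symmetric])
  finally show ?thesis .
qed

text \<open>A differentiable image of an interval is null in the plane. The bound on H in the next
  lemma is given only off the curve, while the average runs over a full square that may meet
  it.\<close>

lemma AE_not_in_curve:
  fixes g :: "real \<Rightarrow> complex"
  assumes "g differentiable_on {0..1}"
  shows "AE p in lborel. w0 + Complex (fst p) (snd p) \<notin> g ` {0..1}"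
proof -
  define c where "c s = (Re (g s - w0), Im (g s - w0))" for s
  have "c differentiable_on {0..1}"
    unfolding differentiable_on_def
  proof
    fix s assume "s \<in> {0..1::real}"
    then obtain g' where "(g has_derivative g') (at s within {0..1})"
      using assms unfolding differentiable_on_def differentiable_def by blast
    then have "(c has_derivative (\<lambda>h. (Re (g' h - 0), Im (g' h - 0)))) (at s within {0..1})"
      unfolding c_def by (intro derivative_intros)
    then show "c differentiable at s within {0..1}"
      by (auto simp: differentiable_def)
  qed
  then have "negligible (c ` {0..1})" "closed (c ` {0..1})"
    by (auto intro: negligible_differentiable_image_lowdim compact_imp_closed
        compact_continuous_image differentiable_imp_continuous_on)
  then have "c ` {0..1} \<in> null_sets lborel"
    by (simp add: negligible_iff_null_sets null_sets_completion_iff borel_closed)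
  then have "AE p in lborel. p \<notin> c ` {0..1}"
    by (rule AE_not_in)
  then show ?thesis
  proof (rule AE_mp, intro AE_I2 impI notI)
    fix p assume p: "p \<notin> c ` {0..1}" and "w0 + Complex (fst p) (snd p) \<in> g ` {0..1}"
    then obtain s where "s \<in> {0..1}" "g s = w0 + Complex (fst p) (snd p)" by auto
    then have "p = c s" by (simp add: c_def)
    with p \<open>s \<in> {0..1}\<close> show False by blast
  qed
qed

text \<open>Averaging over a square of side comparable to the distance \<open>\<rho>\<close> of \<open>w\<close> from \<open>p\<close>: since
  \<open>1 / \<bar>g s - w\<bar>\<close> has integral \<open>O(\<rho>)\<close> over the square, \<open>H w = o(1 / \<rho>)\<close>.\<close>

lemma Cauchy_bounded_singularity:
  fixes H :: "complex \<Rightarrow> complex" and g :: "real \<Rightarrow> complex"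
  assumes S: "open S" "p \<in> S" and H: "H holomorphic_on S - {p}"
    and g: "g differentiable_on {0..1}" and gp: "\<And>s. s \<in> {0<..<1} \<Longrightarrow> g s \<noteq> p" and M: "0 \<le> M"
    and bound: "\<And>w. w \<in> S - {p} \<Longrightarrow> w \<notin> g ` {0..1} \<Longrightarrow> ennreal (norm (H w)) \<le>
      ennreal M * (1 + (\<integral>\<^sup>+s. inverse (ennreal (norm (g s - w))) * indicator {0..1} s \<partial>lborel))"
  shows "((\<lambda>w. (w - p) * H w) \<longlongrightarrow> 0) (at p)"
proof -
  have cg: "continuous_on {0..1} g"
    using g differentiable_imp_continuous_on by blast
  \<comment> \<open>Extension by zero makes g Borel measurable on the line; the indicator of
    \<open>{0..1}\<close> in the integrands hides the change.\<close>
  define gI where "gI s = indicator {0..1} s *\<^sub>R g s" for s :: real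
  have [measurable]: "gI \<in> borel_measurable borel"
    unfolding gI_def by (intro borel_measurable_continuous_on_indicator cg) auto
  have OS: "open (S - {p})"
    using S by auto
  \<comment> \<open>The three summands come from the constant 1 (area of the square), from the
    parameters within \<eta> of an end (two intervals of length \<eta>, each with bound
    \<open>32 * a\<close>), and from the middle parameters (area divided by \<delta>). The factor 4
    is that of \<open>submean_square\<close>.\<close>
  have est: "ennreal (a\<^sup>2 * norm (H w0)) \<le> ennreal (4 * M * (4 * a\<^sup>2 + 64 * a * \<eta> + 4 * a\<^sup>2 / \<delta>))"
    if a: "0 < a" and \<eta>: "0 < \<eta>" "\<eta> < 1/2" and \<delta>: "0 < \<delta>"
      and box: "\<And>x y. \<bar>x\<bar> \<le> a \<Longrightarrow> \<bar>y\<bar> \<le> a \<Longrightarrow> w0 + Complex x y \<in> S - {p}"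
      and far: "\<And>s x y. s \<in> {\<eta>..1-\<eta>} \<Longrightarrow> \<bar>x\<bar> \<le> a \<Longrightarrow> \<bar>y\<bar> \<le> a \<Longrightarrow> \<delta> \<le> norm (g s - (w0 + Complex x y))"
    for a \<eta> \<delta> w0
  proof -
    define Q where "Q = {-a..a} \<times> {-a..a}"
    have [measurable]: "Q \<in> sets borel"
      unfolding Q_def by (intro borel_closed closed_Times) auto
    have emQ: "emeasure lborel Q = ennreal (4 * a\<^sup>2)"
      unfolding Q_def lborel_prod[symmetric] using a
      by (subst lborel.emeasure_pair_measure_Times) (auto simp: ennreal_mult[symmetric] power2_eq_square)
    define kk where "kk s p = inverse (ennreal (norm (gI s - (w0 + Complex (fst p) (snd p))))) * indicator {0..1} s * indicator Q p" for s p
    have mkk[measurable]: "(\<lambda>(s, p). kk s p) \<in> borel_measurable (lborel \<Otimes>\<^sub>M lborel)"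
    proof -
      have [measurable]: "(\<lambda>q::real \<times> real. Complex (fst q) (snd q)) \<in> borel_measurable borel"
        unfolding Complex_eq by (intro borel_measurable_continuous_onI continuous_intros)
      have "(\<lambda>(s, p). kk s p) \<in> borel_measurable (borel \<Otimes>\<^sub>M borel)"
        unfolding kk_def by measurable
      then show ?thesis
        by (simp add: measurable_cong_sets[OF sets_pair_measure_cong[OF sets_lborel sets_lborel] refl])
    qed
    define kh where "kh s = (\<integral>\<^sup>+p. kk s p \<partial>lborel)" for s
    have kh1: "kh s \<le> ennreal (32 * a)" for s
    proof -
      have "kh s \<le> (\<integral>\<^sup>+p. inverse (ennreal (norm ((gI s - w0) - Complex (fst p) (snd p)))) * indicator Q p \<partial>lborel)"
        unfolding kh_def kk_def by (intro nn_integral_mono) (auto simp: algebra_simps split: split_indicator)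
      also have "\<dots> \<le> ennreal (32 * a)"
        unfolding Q_def by (rule nn_integral_inverse_norm_le[OF a])
      finally show ?thesis .
    qed
    have kh2: "kh s \<le> ennreal (4 * a\<^sup>2 / \<delta>)" if s: "s \<in> {\<eta>..1-\<eta>}" for s
    proof -
      have "kh s \<le> (\<integral>\<^sup>+p. ennreal (1 / \<delta>) * indicator Q p \<partial>lborel)"
        unfolding kh_def
      proof (intro nn_integral_mono)
        fix p :: "real \<times> real"
        have "inverse (ennreal (norm (gI s - (w0 + Complex (fst p) (snd p))))) \<le> ennreal (1 / \<delta>)" if p: "p \<in> Q"
        proof -
          have "\<delta> \<le> norm (gI s - (w0 + Complex (fst p) (snd p)))"
            using far[OF s, of "fst p" "snd p"] p s \<eta> by (auto simp: Q_def gI_def)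
          moreover from this have "0 < norm (gI s - (w0 + Complex (fst p) (snd p)))"
            using \<delta> by linarith
          ultimately show ?thesis
            using \<delta> by (subst inverse_ennreal) (auto intro!: ennreal_leI simp: field_simps)
        qed
        then show "kk s p \<le> ennreal (1 / \<delta>) * indicator Q p"
          by (auto simp: kk_def split: split_indicator)
      qed
      also have "\<dots> = ennreal (4 * a\<^sup>2 / \<delta>)"
        using \<delta> by (simp add: nn_integral_cmult_indicator emQ ennreal_mult[symmetric])
      finally show ?thesis .
    qed
    have kh0: "kh s = 0" if "s \<notin> {0..1}" for s
      using that by (simp add: kh_def kk_def)
    have khb: "kh s \<le> ennreal (32 * a) * indicator {0..\<eta>} s + ennreal (32 * a) * indicator {1-\<eta>..1} s
        + ennreal (4 * a\<^sup>2 / \<delta>) * indicator {\<eta>..1-\<eta>} s" for s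
    proof -
      consider "s \<notin> {0..1}" | "s \<in> {0..\<eta>}" | "s \<in> {1-\<eta>..1}" | "s \<in> {\<eta>..1-\<eta>}" by force
      then show ?thesis
        using kh0[of s] kh1[of s] kh2[of s]
        by cases (auto split: split_indicator intro: order_trans add_increasing2 simp: add_increasing add_increasing2)
    qed
    have "(\<integral>\<^sup>+s. kh s \<partial>lborel) \<le> (\<integral>\<^sup>+s. ennreal (32 * a) * indicator {0..\<eta>} s + ennreal (32 * a) * indicator {1-\<eta>..1} s
        + ennreal (4 * a\<^sup>2 / \<delta>) * indicator {\<eta>..1-\<eta>} s \<partial>lborel)"
      by (intro nn_integral_mono khb)
    also have "\<dots> = ennreal (32 * a) * ennreal \<eta> + ennreal (32 * a) * ennreal \<eta> + ennreal (4 * a\<^sup>2 / \<delta>) * ennreal (1 - 2 * \<eta>)"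
      using \<eta> by (subst nn_integral_add; measurable?)+ (simp add: nn_integral_cmult_indicator)
    also have "\<dots> = ennreal (64 * a * \<eta> + 4 * a\<^sup>2 / \<delta> * (1 - 2 * \<eta>))"
      using \<eta> a \<delta> by (simp add: ennreal_mult[symmetric] ennreal_plus[symmetric] del: ennreal_plus)
    also have "\<dots> \<le> ennreal (64 * a * \<eta> + 4 * a\<^sup>2 / \<delta>)"
      using \<eta> a \<delta> mult_left_mono[of "1 - 2 * \<eta>" 1 "4 * a\<^sup>2 / \<delta>"] by (intro ennreal_leI) auto
    finally have khI: "(\<integral>\<^sup>+s. kh s \<partial>lborel) \<le> ennreal (64 * a * \<eta> + 4 * a\<^sup>2 / \<delta>)" .
    have "ennreal (a\<^sup>2 * norm (H w0)) \<le>
        4 * (\<integral>\<^sup>+p. ennreal (norm (H (w0 + Complex (fst p) (snd p)))) * indicator Q p \<partial>lborel)"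
      unfolding Q_def by (rule submean_square[OF OS H a box])
    also have "(\<integral>\<^sup>+p. ennreal (norm (H (w0 + Complex (fst p) (snd p)))) * indicator Q p \<partial>lborel)
        \<le> (\<integral>\<^sup>+p. ennreal M * (indicator Q p + (\<integral>\<^sup>+s. kk s p \<partial>lborel)) \<partial>lborel)"
    proof (rule nn_integral_mono_AE, rule AE_mp[OF AE_not_in_curve[OF g, of w0]], intro AE_I2 impI)
      fix q assume q: "w0 + Complex (fst q) (snd q) \<notin> g ` {0..1}"
      show "ennreal (norm (H (w0 + Complex (fst q) (snd q)))) * indicator Q q
          \<le> ennreal M * (indicator Q q + (\<integral>\<^sup>+s. kk s q \<partial>lborel))"
      proof (cases "q \<in> Q")
        case True
        then have "w0 + Complex (fst q) (snd q) \<in> S - {p}"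
          by (intro box) (auto simp: Q_def)
        from bound[OF this q] have "ennreal (norm (H (w0 + Complex (fst q) (snd q)))) \<le> ennreal M *
           (1 + (\<integral>\<^sup>+s. inverse (ennreal (norm (g s - (w0 + Complex (fst q) (snd q))))) * indicator {0..1} s \<partial>lborel))" .
        also have "(\<integral>\<^sup>+s. inverse (ennreal (norm (g s - (w0 + Complex (fst q) (snd q))))) * indicator {0..1} s \<partial>lborel)
            = (\<integral>\<^sup>+s. kk s q \<partial>lborel)"
          using True by (intro nn_integral_cong) (auto simp: kk_def gI_def split: split_indicator)
        finally show ?thesis using True by simp
      qed auto
    qed
    also have "\<dots> = ennreal M * (ennreal (4 * a\<^sup>2) + (\<integral>\<^sup>+p. \<integral>\<^sup>+s. kk s p \<partial>lborel \<partial>lborel))"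
      by (subst nn_integral_cmult, measurable) (subst nn_integral_add, measurable, simp add: emQ)
    \<comment> \<open>For a fixed point of the square no bound on the integral over s is at hand;
      after the exchange each s contributes at most \<open>32 * a\<close>, however close
      \<open>g s\<close> comes to the square.\<close>
    also have "(\<integral>\<^sup>+p. \<integral>\<^sup>+s. kk s p \<partial>lborel \<partial>lborel) = (\<integral>\<^sup>+s. kh s \<partial>lborel)"
      unfolding kh_def using lborel_pair.Fubini'[OF mkk] by simp
    also have "4 * (ennreal M * (ennreal (4 * a\<^sup>2) + \<dots>)) \<le>
        4 * (ennreal M * (ennreal (4 * a\<^sup>2) + ennreal (64 * a * \<eta> + 4 * a\<^sup>2 / \<delta>)))"
      by (intro mult_left_mono add_left_mono khI) auto
    also have "\<dots> = ennreal (4 * M * (4 * a\<^sup>2 + 64 * a * \<eta> + 4 * a\<^sup>2 / \<delta>))"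
    proof -
      have "4 * (ennreal M * (ennreal X + ennreal Y)) = ennreal (4 * (M * (X + Y)))"
        if "0 \<le> X" "0 \<le> Y" for X Y
        using M that by (simp add: ennreal_mult)
      from this[of "4 * a\<^sup>2" "64 * a * \<eta> + 4 * a\<^sup>2 / \<delta>"] a \<eta> \<delta>
      have "4 * (ennreal M * (ennreal (4 * a\<^sup>2) + ennreal (64 * a * \<eta> + 4 * a\<^sup>2 / \<delta>))) =
          ennreal (4 * (M * (4 * a\<^sup>2 + (64 * a * \<eta> + 4 * a\<^sup>2 / \<delta>))))"
        by (auto intro!: add_nonneg_nonneg)
      then show ?thesis
        by (simp add: mult.assoc add.assoc)
    qed
    finally show ?thesis by (simp add: mult_left_mono)
  qed
  obtain R where R: "0 < R" "ball p R \<subseteq> S"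
    using S openE by blast
  show ?thesis
  proof (rule tendstoI)
    fix \<epsilon> :: real assume \<epsilon>: "0 < \<epsilon>"
    \<comment> \<open>This makes the end contribution \<open>16 * M * 64 * \<eta>\<close> smaller
      than \<epsilon>; the 1 in the denominator allows \<open>M = 0\<close>.\<close>
    define \<eta> where "\<eta> = min (1/4) (\<epsilon> / (1 + 16 * M * 64) / 2)"
    have den: "0 < 1 + 16 * M * 64"
      using M by auto
    have \<eta>: "0 < \<eta>" "\<eta> < 1/2"
      using \<epsilon> den by (auto simp: \<eta>_def)
    have small: "16 * M * 64 * \<eta> < \<epsilon>"
    proof -
      have "16 * M * 64 * \<eta> \<le> (1 + 16 * M * 64) * \<eta>"
        using \<eta> by (simp add: algebra_simps)
      also have "\<dots> \<le> (1 + 16 * M * 64) * (\<epsilon> / (1 + 16 * M * 64) / 2)"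
        using den by (intro mult_left_mono) (auto simp: \<eta>_def)
      also have "\<dots> = \<epsilon> / 2"
        using den by (metis less_irrefl nonzero_mult_div_cancel_left times_divide_eq_right)
      finally show ?thesis using \<epsilon> by simp
    qed
    \<comment> \<open>p may itself be an end point of the curve, so a positive distance is available
      only for parameters at least \<eta> away from both ends.\<close>
    obtain \<delta> where \<delta>: "0 < \<delta>" "\<And>s. s \<in> {\<eta>..1-\<eta>} \<Longrightarrow> 2 * \<delta> \<le> dist p (g s)"
    proof -
      have "compact (g ` {\<eta>..1-\<eta>})"
        using \<eta> by (intro compact_continuous_image continuous_on_subset[OF cg]) auto
      moreover have "p \<notin> g ` {\<eta>..1-\<eta>}"
      proof
        assume "p \<in> g ` {\<eta>..1-\<eta>}"
        then obtain s where "s \<in> {\<eta>..1-\<eta>}" "g s = p" by blast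
        with gp[of s] \<eta> show False by simp
      qed
      ultimately obtain d where "0 < d" "\<forall>x\<in>g ` {\<eta>..1-\<eta>}. d \<le> dist p x"
        using separate_point_closed compact_imp_closed by metis
      then show ?thesis
        by (intro that[of "d/2"]) auto
    qed
    have "((\<lambda>w. 16 * M * (norm (w - p) + 64 * \<eta> + norm (w - p) / \<delta>)) \<longlongrightarrow> 16 * M * (norm (p - p) + 64 * \<eta> + norm (p - p) / \<delta>)) (at p)"
      using \<delta> by (intro tendsto_intros) auto
    then have "\<forall>\<^sub>F w in at p. 16 * M * (norm (w - p) + 64 * \<eta> + norm (w - p) / \<delta>) < \<epsilon>"
      by (rule order_tendstoD) (use small in \<open>simp add: mult.assoc\<close>)
    moreover have "\<forall>\<^sub>F w in at p. norm (w - p) < min (R/2) (\<delta>/2) \<and> w \<noteq> p"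
      unfolding eventually_at using R \<delta> by (intro exI[of _ "min (R/2) (\<delta>/2)"]) (auto simp: dist_norm)
    ultimately show "\<forall>\<^sub>F w in at p. dist ((w - p) * H w) 0 < \<epsilon>"
    proof eventually_elim
      case (elim w0)
      \<comment> \<open>With this half-side every point of the square has distance between 2a and 6a
        from p. The square thus avoids p, and as 6a < \<delta> it keeps distance \<delta> from the
        middle part of the curve.\<close>
      define a where "a = norm (w0 - p) / 4"
      have a: "0 < a" "norm (w0 - p) = 4 * a"
        using elim by (auto simp: a_def)
      have cl: "norm (Complex x y) \<le> 2 * a" if "\<bar>x\<bar> \<le> a" "\<bar>y\<bar> \<le> a" for x y
        using cmod_le[of "Complex x y"] that by simp
      have "ennreal (a\<^sup>2 * norm (H w0)) \<le> ennreal (4 * M * (4 * a\<^sup>2 + 64 * a * \<eta> + 4 * a\<^sup>2 / \<delta>))"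
      proof (rule est[OF a(1) \<eta> \<delta>(1)])
        fix x y :: real assume xy: "\<bar>x\<bar> \<le> a" "\<bar>y\<bar> \<le> a"
        have "norm (w0 + Complex x y - p) \<le> norm (w0 - p) + norm (Complex x y)"
          using norm_triangle_ineq[of "w0 - p" "Complex x y"] by (simp add: algebra_simps)
        then have up: "norm (w0 + Complex x y - p) \<le> 6 * a"
          using cl[OF xy] a by simp
        have "norm (w0 - p) - norm (Complex x y) \<le> norm (w0 + Complex x y - p)"
          using norm_diff_ineq[of "w0 - p" "Complex x y"] by (simp add: algebra_simps)
        then have "norm (w0 + Complex x y - p) > 0"
          using cl[OF xy] a by linarith
        moreover have "w0 + Complex x y \<in> ball p R"
          using up elim a by (simp add: dist_norm norm_minus_commute)
        ultimately show "w0 + Complex x y \<in> S - {p}"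
          using R by auto
        show "\<delta> \<le> norm (g s - (w0 + Complex x y))" if s: "s \<in> {\<eta>..1-\<eta>}" for s
        proof -
          have "norm (g s - p) \<le> norm (g s - (w0 + Complex x y)) + norm (w0 + Complex x y - p)"
            using norm_triangle_ineq[of "g s - (w0 + Complex x y)" "w0 + Complex x y - p"] by simp
          then show ?thesis
            using \<delta>(2)[OF s] up elim a by (simp add: dist_norm norm_minus_commute)
        qed
      qed
      then have "a\<^sup>2 * norm (H w0) \<le> 4 * M * (4 * a\<^sup>2 + 64 * a * \<eta> + 4 * a\<^sup>2 / \<delta>)"
        by (subst (asm) ennreal_le_iff) (use M a \<eta> \<delta> in \<open>auto intro!: mult_nonneg_nonneg add_nonneg_nonneg\<close>)
      then have "4 / a * (a\<^sup>2 * norm (H w0)) \<le> 4 / a * (4 * M * (4 * a\<^sup>2 + 64 * a * \<eta> + 4 * a\<^sup>2 / \<delta>))"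
        using a by (intro mult_left_mono) auto
      also have "4 / a * (a\<^sup>2 * norm (H w0)) = norm (w0 - p) * norm (H w0)"
        using a by (simp add: power2_eq_square)
      also have "4 / a * (4 * M * (4 * a\<^sup>2 + 64 * a * \<eta> + 4 * a\<^sup>2 / \<delta>)) =
          16 * M * (norm (w0 - p) + 64 * \<eta> + norm (w0 - p) / \<delta>)"
        using a \<delta> by (simp add: power2_eq_square field_simps)
      finally show ?case
        using elim by (simp add: norm_mult)
    qed
  qed
qed

section \<open>The two sides of the curve\<close>

locale lune_domain =
  fixes g :: "real \<Rightarrow> complex" and D :: "complex set"
  assumes lune: "lune g D"
begin

definition tangent :: "real \<Rightarrow> complex" where "tangent s = vector_derivative g (at s)"

lemma simple: "simple_path g"
  and C1: "g C1_differentiable_on {0..1}"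
  and tangent_nonzero: "s \<in> {0..1} \<Longrightarrow> tangent s \<noteq> 0"
  and in_ball: "s \<in> {0<..<1} \<Longrightarrow> g s \<in> ball 0 1"
  and two_components: "card (components (ball 0 1 - curve_in_disk g)) = 2"
  and D_component: "D \<in> components (ball 0 1 - curve_in_disk g)"
  and left: "s \<in> {0<..<1} \<Longrightarrow> \<forall>\<^sub>F e in at_right 0. g s + of_real e * (\<i> * tangent s) \<in> D"
  using lune unfolding lune_def smooth_curve_in_disk_def divides_disk_into_two_domains_def
    positively_oriented_wrt_def tangent_def image_subset_iff by blast+

lemma has_tangent: "s \<in> {0..1} \<Longrightarrow> (g has_vector_derivative tangent s) (at s)"
  using C1 unfolding C1_differentiable_on_eq tangent_def by (simp add: vector_derivative_works)

lemma continuous_tangent: "continuous_on {0..1} tangent"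
  using C1 unfolding C1_differentiable_on_eq tangent_def[abs_def] by blast

lemma continuous_g: "continuous_on {0..1} g"
  using simple by (simp add: simple_path_def path_def)

lemma disk_minus_curve: "ball 0 1 - curve_in_disk g = ball 0 1 - path_image g"
  by (auto simp: curve_in_disk_def)

lemma closed_path_image_g: "closed (path_image g)"
  using simple by (simp add: closed_simple_path_image)

lemma open_disk_minus_curve: "open (ball 0 1 - path_image g)"
  using closed_path_image_g by blast

lemma open_D: "open D"
  using D_component open_disk_minus_curve open_components disk_minus_curve by metis

lemma D_subset: "D \<subseteq> ball 0 1 - path_image g"
  using D_component in_components_subset disk_minus_curve by metis

lemma g_eq_interior:
  assumes "s \<in> {0<..<1}" "s' \<in> {0..1}" "g s' = g s"
  shows "s' = s"
  using simple assms unfolding simple_path_def loop_free_def by fastforce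

text \<open>Division by the tangent at s0 brings the derivative close to 1, so that the curve
  becomes a graph over the real axis. Displacing along the fixed direction
  \<open>\<i> * tangent s0\<close>, not along the moving normal, makes (s, e) usable as coordinates
  although the curve is merely C1. Simplicity of the path keeps the other parameters away from
  \<open>g s0\<close>.\<close>

lemma local_strip:
  assumes s0: "s0 \<in> {0<..<1}"
  obtains c d b r where "0 < c" "c < s0" "s0 < d" "d < 1" "0 < b" "0 < r"
    "strict_mono_on {c..d} (\<lambda>s. Re (g s / tangent s0))"
    "ball (g s0) r \<subseteq> ball 0 1"
    "\<And>s e. s \<in> {c..d} \<Longrightarrow> \<bar>e\<bar> \<le> b \<Longrightarrow> e \<noteq> 0 \<Longrightarrow> g s + of_real e * (\<i> * tangent s0) \<in> ball 0 1 - path_image g"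
    "\<And>w. w \<in> ball (g s0) r \<Longrightarrow> \<exists>s\<in>{c<..<d}. \<exists>e. \<bar>e\<bar> < b \<and> w = g s + of_real e * (\<i> * tangent s0)"
proof -
  define T0 where "T0 = tangent s0"
  define p where "p = g s0"
  have T0: "T0 \<noteq> 0" using tangent_nonzero[of s0] s0 by (auto simp: T0_def)
  have "isCont tangent s0"
    using continuous_tangent s0 by (metis at_within_interior continuous_on_eq_continuous_within
        greaterThanLessThan_iff greaterThanLessThan_subseteq_atLeastAtMost_iff interior_atLeastAtMost_real
        less_eq_real_def atLeastAtMost_iff)
  then have "\<forall>\<^sub>F s in at s0. dist (tangent s) T0 < norm T0 / 2"
    unfolding T0_def isCont_def using T0 by (intro tendstoD) (auto simp: T0_def)
  then obtain \<delta>1 where \<delta>1: "0 < \<delta>1" "\<And>s. dist s s0 < \<delta>1 \<Longrightarrow> dist (tangent s) T0 \<le> norm T0 / 2"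
    unfolding eventually_at using T0 by (metis T0_def dist_self less_eq_real_def UNIV_I
        zero_less_divide_iff zero_less_norm_iff zero_less_numeral)
  define \<delta> where "\<delta> = min (\<delta>1/2) (min (s0/2) ((1 - s0)/2))"
  have \<delta>: "0 < \<delta>" "0 < s0 - \<delta>" "s0 + \<delta> < 1"
  proof -
    have "\<delta> \<le> s0 / 2" "\<delta> \<le> (1 - s0) / 2" unfolding \<delta>_def by linarith+
    with s0 show "0 < s0 - \<delta>" "s0 + \<delta> < 1" by auto
    show "0 < \<delta>" using \<delta>1 s0 by (simp add: \<delta>_def)
  qed
  define G where "G s = g s / T0" for s
  have G': "(G has_vector_derivative tangent s / T0) (at s)" if "s \<in> {s0 - \<delta>..s0 + \<delta>}" for s
    unfolding G_def using that \<delta> by (intro has_vector_derivative_divide has_tangent) auto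
  have T1: "norm (tangent s / T0 - 1) \<le> 1/2" if "s \<in> {s0 - \<delta>..s0 + \<delta>}" for s
  proof -
    have "\<delta> \<le> \<delta>1 / 2" unfolding \<delta>_def by linarith
    then have "dist s s0 < \<delta>1"
      using that \<delta>1(1) unfolding dist_real_def atLeastAtMost_iff by linarith
    from \<delta>1(2)[OF this] have "norm ((tangent s - T0) / T0) \<le> 1/2"
      using T0 by (simp add: norm_divide dist_norm divide_simps)
    then show ?thesis using T0 by (simp add: diff_divide_distrib)
  qed
  \<comment> \<open>The mean value theorem is applied to real and imaginary part separately, each
    with its own intermediate point; the constants come from
    \<open>norm (tangent s / T0 - 1) \<le> 1/2\<close>.\<close>
  have Xinc: "(y - x) / 2 \<le> Re (G y - G x)" and Ybd: "\<bar>Im (G y - G x)\<bar> \<le> (y - x) / 2"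
    and Xup: "Re (G y - G x) \<le> 3/2 * (y - x)"
    if xy: "x \<in> {s0 - \<delta>..s0 + \<delta>}" "y \<in> {s0 - \<delta>..s0 + \<delta>}" "x \<le> y" for x y
  proof -
    have "(y - x) / 2 \<le> Re (G y - G x) \<and> Re (G y - G x) \<le> 3/2 * (y - x) \<and> \<bar>Im (G y - G x)\<bar> \<le> (y - x) / 2"
    proof (cases "x = y")
      case False
      then have lt: "x < y" using xy by simp
      have "\<exists>z>x. z < y \<and> Re (G y) - Re (G x) = (y - x) * Re (tangent z / T0)"
      proof (rule MVT2[OF lt])
        fix z assume z: "x \<le> z" "z \<le> y"
        have "((\<lambda>s. Re (G s)) has_vector_derivative Re (tangent z / T0)) (at z)"
          using G'[of z] xy z by (intro bounded_linear.has_vector_derivative[OF bounded_linear_Re]) auto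
        then show "((\<lambda>s. Re (G s)) has_real_derivative Re (tangent z / T0)) (at z)"
          by (simp add: has_real_derivative_iff_has_vector_derivative)
      qed
      then obtain z1 where z1: "x < z1" "z1 < y" "Re (G y) - Re (G x) = (y - x) * Re (tangent z1 / T0)" by blast
      have "\<exists>z>x. z < y \<and> Im (G y) - Im (G x) = (y - x) * Im (tangent z / T0)"
      proof (rule MVT2[OF lt])
        fix z assume z: "x \<le> z" "z \<le> y"
        have "((\<lambda>s. Im (G s)) has_vector_derivative Im (tangent z / T0)) (at z)"
          using G'[of z] xy z by (intro bounded_linear.has_vector_derivative[OF bounded_linear_Im]) auto
        then show "((\<lambda>s. Im (G s)) has_real_derivative Im (tangent z / T0)) (at z)"
          by (simp add: has_real_derivative_iff_has_vector_derivative)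
      qed
      then obtain z2 where z2: "x < z2" "z2 < y" "Im (G y) - Im (G x) = (y - x) * Im (tangent z2 / T0)" by blast
      have r: "1/2 \<le> Re (tangent z1 / T0)" "Re (tangent z1 / T0) \<le> 3/2"
        using abs_Re_le_cmod[of "tangent z1 / T0 - 1"] T1[of z1] z1 xy by (auto simp: abs_le_iff)
      have i: "\<bar>Im (tangent z2 / T0)\<bar> \<le> 1/2"
        using abs_Im_le_cmod[of "tangent z2 / T0 - 1"] T1[of z2] z2 xy by auto
      have "(y - x) * (1/2) \<le> (y - x) * Re (tangent z1 / T0)" "(y - x) * Re (tangent z1 / T0) \<le> (y - x) * (3/2)"
        using r lt by (auto intro!: mult_left_mono simp del: times_divide_eq_right)
      moreover have "\<bar>y - x\<bar> * \<bar>Im (tangent z2 / T0)\<bar> \<le> (y - x) * (1/2)"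
        using i lt by (auto intro!: mult_left_mono simp del: times_divide_eq_right)
      ultimately show ?thesis
        using z1(3) z2(3) by (simp add: abs_mult)
    qed simp
    then show "(y - x) / 2 \<le> Re (G y - G x)" "\<bar>Im (G y - G x)\<bar> \<le> (y - x) / 2"
      "Re (G y - G x) \<le> 3/2 * (y - x)" by blast+
  qed
  have Gbd: "norm (G s - G s0) \<le> 2 * \<bar>s - s0\<bar>" if s: "s \<in> {s0 - \<delta>..s0 + \<delta>}" for s
  proof (cases "s0 \<le> s")
    case True
    then have "\<bar>Re (G s - G s0)\<bar> \<le> 3/2 * \<bar>s - s0\<bar>" "\<bar>Im (G s - G s0)\<bar> \<le> 1/2 * \<bar>s - s0\<bar>"
      using Xinc[of s0 s] Xup[of s0 s] Ybd[of s0 s] s \<delta> by auto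
    then show ?thesis using cmod_le[of "G s - G s0"] by linarith
  next
    case False
    then have "\<bar>Re (G s0 - G s)\<bar> \<le> 3/2 * \<bar>s - s0\<bar>" "\<bar>Im (G s0 - G s)\<bar> \<le> 1/2 * \<bar>s - s0\<bar>"
      using Xinc[of s s0] Xup[of s s0] Ybd[of s s0] s \<delta> by auto
    then show ?thesis using cmod_le[of "G s0 - G s"] by (simp add: norm_minus_commute)
  qed
  define K where "K = g ` ({0..s0 - \<delta>} \<union> {s0 + \<delta>..1})"
  have "closed K"
    unfolding K_def using \<delta>
    by (intro compact_imp_closed compact_continuous_image continuous_on_subset[OF continuous_g]) auto
  moreover have "p \<notin> K"
  proof
    assume "p \<in> K"
    then obtain s where s: "s \<in> {0..s0 - \<delta>} \<union> {s0 + \<delta>..1}" "g s = g s0"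
      unfolding K_def p_def by force
    moreover have "s \<in> {0..1}" using s \<delta> by auto
    ultimately have "s = s0" using g_eq_interior[OF s0] by blast
    with s \<delta> show False by auto
  qed
  moreover have "p \<in> ball 0 1"
    using in_ball[OF s0] by (simp add: p_def)
  ultimately have "open (ball 0 1 - K)" "p \<in> ball 0 1 - K" by auto
  then obtain d0 where d0: "0 < d0" "ball p d0 \<subseteq> ball 0 1 - K"
    using openE by blast
  \<comment> \<open>\<delta>' and b bound the displacements along and across the curve by
    \<open>d0 / 4\<close> each, so the strip stays in \<open>ball p d0\<close>, away from K. r makes
    \<alpha> below shorter than \<open>\<delta>' / 2\<close> and \<open>b / 2\<close>, which leaves
    room for the coordinates of w.\<close>
  define \<delta>' where "\<delta>' = min \<delta> (d0 / (8 * norm T0))"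
  define b where "b = d0 / (4 * norm T0)"
  define r where "r = min d0 (min (norm T0 * \<delta>' / 2) (b * norm T0 / 2))"
  have pos: "0 < \<delta>'" "\<delta>' \<le> \<delta>" "0 < b" "0 < r"
    using d0 T0 \<delta> by (auto simp: \<delta>'_def b_def r_def)
  show ?thesis
  proof (rule that[of "s0 - \<delta>'" "s0 + \<delta>'" b r])
    show "strict_mono_on {s0 - \<delta>'..s0 + \<delta>'} (\<lambda>s. Re (g s / tangent s0))"
    proof (rule strict_mono_onI)
      fix x y assume "x \<in> {s0 - \<delta>'..s0 + \<delta>'}" "y \<in> {s0 - \<delta>'..s0 + \<delta>'}" "x < y"
      then show "Re (g x / tangent s0) < Re (g y / tangent s0)"
        using Xinc[of x y] pos by (simp add: G_def T0_def)
    qed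
    show "ball (g s0) r \<subseteq> ball 0 1"
      using d0 by (auto simp: r_def p_def)
    show "g s + of_real e * (\<i> * tangent s0) \<in> ball 0 1 - path_image g"
      if s: "s \<in> {s0 - \<delta>'..s0 + \<delta>'}" and e: "\<bar>e\<bar> \<le> b" "e \<noteq> 0" for s e
    proof -
      let ?w = "g s + of_real e * (\<i> * T0)"
      have "norm (?w - p) \<le> norm (g s - p) + norm (of_real e * (\<i> * T0))"
        using norm_triangle_ineq[of "g s - p" "of_real e * (\<i> * T0)"] by (simp add: algebra_simps)
      also have "norm (g s - p) = norm T0 * norm (G s - G s0)"
        using T0 by (simp add: G_def p_def diff_divide_distrib[symmetric] norm_divide)
      also have "\<dots> \<le> norm T0 * (2 * \<delta>')"
      proof -
        have J: "s \<in> {s0 - \<delta>..s0 + \<delta>}" "\<bar>s - s0\<bar> \<le> \<delta>'" using s pos by auto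
        have "norm (G s - G s0) \<le> 2 * \<delta>'"
          by (rule order_trans[OF Gbd[OF J(1)]]) (use J(2) in simp)
        then show ?thesis by (intro mult_left_mono) auto
      qed
      also have "norm T0 * (2 * \<delta>') \<le> norm T0 * (2 * (d0 / (8 * norm T0)))"
        by (intro mult_left_mono) (auto simp: \<delta>'_def)
      also have "\<dots> = d0 / 4" using T0 by simp
      also have "norm (of_real e * (\<i> * T0)) \<le> b * norm T0"
        using e by (simp add: norm_mult mult_right_mono)
      also have "b * norm T0 = d0 / 4" using T0 by (simp add: b_def)
      finally have "?w \<in> ball p d0"
        using d0 by (simp add: dist_norm norm_minus_commute)
      then have w: "?w \<in> ball 0 1 - K" using d0 by blast
      moreover have "?w \<notin> path_image g"
      proof
        assume "?w \<in> path_image g"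
        then obtain s' where s': "s' \<in> {0..1}" "?w = g s'" by (auto simp: path_image_def)
        then have J: "s' \<in> {s0 - \<delta>..s0 + \<delta>}"
          using w by (auto simp: K_def)
        have "G s' = G s + of_real e * \<i>"
          unfolding G_def s'(2)[symmetric] using T0 by (simp add: add_divide_distrib)
        then have "Re (G s') = Re (G s)" by simp
        then have "s' = s"
          using Xinc[of s s'] Xinc[of s' s] J s pos by fastforce
        then show False using s'(2) e T0 by simp
      qed
      ultimately show ?thesis by (simp add: T0_def)
    qed
    show "\<exists>s\<in>{s0 - \<delta>'<..<s0 + \<delta>'}. \<exists>e. \<bar>e\<bar> < b \<and> w = g s + of_real e * (\<i> * tangent s0)"
      if w: "w \<in> ball (g s0) r" for w
    proof -
      define \<alpha> where "\<alpha> = (w - p) / T0"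
      have n\<alpha>: "norm \<alpha> * norm T0 < r"
        using w T0 by (simp add: \<alpha>_def norm_divide p_def dist_norm norm_minus_commute)
      have "norm \<alpha> * norm T0 < \<delta>' / 2 * norm T0" "norm \<alpha> * norm T0 < b / 2 * norm T0"
        using n\<alpha> by (auto simp: r_def mult_ac)
      then have \<alpha>1: "norm \<alpha> < \<delta>' / 2" and \<alpha>2: "norm \<alpha> < b / 2"
        by (auto simp del: times_divide_eq_left dest: mult_right_less_imp_less)
      have Ra: "\<bar>Re \<alpha>\<bar> < \<delta>' / 2" using abs_Re_le_cmod[of \<alpha>] \<alpha>1 by linarith
      have "Re (G (s0 - \<delta>')) \<le> Re (G s0) + Re \<alpha>" "Re (G s0) + Re \<alpha> \<le> Re (G (s0 + \<delta>'))"
        using Xinc[of "s0 - \<delta>'" s0] Xinc[of s0 "s0 + \<delta>'"] pos Ra by auto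
      moreover have "continuous_on {s0 - \<delta>'..s0 + \<delta>'} (\<lambda>s. Re (G s))"
        unfolding G_def using pos \<delta> T0
        by (intro continuous_intros continuous_on_subset[OF continuous_g]) auto
      \<comment> \<open>This is the foot of w on the curve in the direction
        \<open>\<i> * T0\<close>; the increment bounds then confine both coordinates of w.\<close>
      ultimately obtain s where s: "s0 - \<delta>' \<le> s" "s \<le> s0 + \<delta>'" "Re (G s) = Re (G s0) + Re \<alpha>"
        using IVT'[of "\<lambda>s. Re (G s)" "s0 - \<delta>'" "Re (G s0) + Re \<alpha>" "s0 + \<delta>'"] pos by auto
      have ss: "\<bar>s - s0\<bar> \<le> 2 * \<bar>Re \<alpha>\<bar>" and Ys: "\<bar>Im (G s - G s0)\<bar> \<le> \<bar>s - s0\<bar> / 2"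
      proof -
        have "\<bar>s - s0\<bar> \<le> 2 * \<bar>Re \<alpha>\<bar> \<and> \<bar>Im (G s - G s0)\<bar> \<le> \<bar>s - s0\<bar> / 2"
        proof (cases "s0 \<le> s")
          case True
          then show ?thesis
            using Xinc[of s0 s] Ybd[of s0 s] s pos by auto
        next
          case False
          then show ?thesis
            using Xinc[of s s0] Ybd[of s s0] s pos by (auto simp: abs_minus_commute)
        qed
        then show "\<bar>s - s0\<bar> \<le> 2 * \<bar>Re \<alpha>\<bar>" "\<bar>Im (G s - G s0)\<bar> \<le> \<bar>s - s0\<bar> / 2" by auto
      qed
      define e where "e = Im \<alpha> - Im (G s - G s0)"
      have "\<bar>e\<bar> < b"
      proof -
        have "\<bar>Im (G s - G s0)\<bar> \<le> \<bar>s - s0\<bar> / 2" by (rule Ys)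
        also have "\<dots> \<le> \<bar>Re \<alpha>\<bar>" using ss by simp
        also have "\<dots> \<le> norm \<alpha>" by (rule abs_Re_le_cmod)
        finally have "\<bar>Im \<alpha>\<bar> + \<bar>Im (G s - G s0)\<bar> \<le> norm \<alpha> + norm \<alpha>"
          by (intro add_mono abs_Im_le_cmod)
        then have "\<bar>e\<bar> \<le> norm \<alpha> + norm \<alpha>"
          unfolding e_def by (rule order_trans[OF abs_triangle_ineq4])
        then show ?thesis using \<alpha>2 by simp
      qed
      moreover have "s \<in> {s0 - \<delta>'<..<s0 + \<delta>'}"
        using ss Ra by (auto simp: abs_le_iff abs_less_iff)
      moreover have "w = g s + of_real e * (\<i> * T0)"
      proof -
        have "\<alpha> = G s - G s0 + of_real e * \<i>"
          using s(3) by (simp add: complex_eq_iff e_def)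
        moreover have "\<alpha> * T0 = w - p" "G s * T0 = g s" "G s0 * T0 = p"
          using T0 by (simp_all add: \<alpha>_def G_def p_def)
        ultimately show ?thesis
          by algebra
      qed
      ultimately show ?thesis by (auto simp: T0_def)
    qed
  qed (use pos \<delta> in auto)
qed

text \<open>The upper half of the strip is connected and misses \<Gamma>, so one point in D
  suffices. At s0 itself the strip direction is the left normal, and the orientation condition
  supplies this point.\<close>

lemma strip_above:
  assumes s0: "s0 \<in> {0<..<1}" and c: "c < s0" "s0 < d" and b: "0 < b"
    and strip: "\<And>s e. s \<in> {c..d} \<Longrightarrow> \<bar>e\<bar> \<le> b \<Longrightarrow> e \<noteq> 0 \<Longrightarrow> g s + of_real e * (\<i> * tangent s0) \<in> ball 0 1 - path_image g"
    and cd: "0 < c" "d < 1"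
    and s: "s \<in> {c..d}" "e \<in> {0<..b}"
  shows "g s + of_real e * (\<i> * tangent s0) \<in> D"
proof -
  let ?V = "(\<lambda>(s, e). g s + of_real e * (\<i> * tangent s0)) ` ({c..d} \<times> {0<..b})"
  have "connected ?V"
  proof (rule connected_continuous_image)
    show "continuous_on ({c..d} \<times> {0<..b}) (\<lambda>(s, e). g s + of_real e * (\<i> * tangent s0))"
      unfolding case_prod_unfold
      by (intro continuous_intros continuous_on_compose2[OF continuous_g]) (use cd in auto)
    show "connected ({c..d} \<times> {0<..b})"
      by (intro connected_Times) auto
  qed
  moreover have "?V \<subseteq> ball 0 1 - curve_in_disk g"
    unfolding disk_minus_curve using strip by (force)
  moreover have "D \<inter> ?V \<noteq> {}"
  proof -
    have "\<forall>\<^sub>F e in at_right 0. e \<in> {0<..b}"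
      using b by (auto simp: eventually_at_right_field intro!: exI[of _ b])
    with left[OF s0] have "\<forall>\<^sub>F e in at_right 0. g s0 + of_real e * (\<i> * tangent s0) \<in> D \<and> e \<in> {0<..b}"
      by (rule eventually_conj)
    then obtain e where "g s0 + of_real e * (\<i> * tangent s0) \<in> D" "e \<in> {0<..b}"
      using eventually_happens trivial_limit_at_right_real by blast
    then show ?thesis using c by force
  qed
  ultimately have "?V \<subseteq> D"
    by (rule components_maximal[OF D_component])
  then show ?thesis using s by force
qed

text \<open>By connectedness one point of D puts the whole lower half in D; with the upper half and
  \<Gamma> it fills a neighbourhood of \<open>g s0\<close>. The lemma is used contrapositively, to
  keep D out of the lower half.\<close>

lemma strip_below_imp_interior:
  assumes s0: "s0 \<in> {0<..<1}" and cd: "0 < c" "c < s0" "s0 < d" "d < 1" and b: "0 < b" and r: "0 < r"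
    and strip: "\<And>s e. s \<in> {c..d} \<Longrightarrow> \<bar>e\<bar> \<le> b \<Longrightarrow> e \<noteq> 0 \<Longrightarrow> g s + of_real e * (\<i> * tangent s0) \<in> ball 0 1 - path_image g"
    and cover: "\<And>w. w \<in> ball (g s0) r \<Longrightarrow> \<exists>s\<in>{c<..<d}. \<exists>e. \<bar>e\<bar> < b \<and> w = g s + of_real e * (\<i> * tangent s0)"
    and s: "s \<in> {c..d}" and e: "e \<in> {-b..<0}"
    and inD: "g s + of_real e * (\<i> * tangent s0) \<in> D"
  shows "g s0 \<in> interior (D \<union> path_image g)"
proof -
  let ?V = "(\<lambda>(s, e). g s + of_real e * (\<i> * tangent s0)) ` ({c..d} \<times> {-b..<0})"
  have "connected ?V"
  proof (rule connected_continuous_image)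
    show "continuous_on ({c..d} \<times> {-b..<0}) (\<lambda>(s, e). g s + of_real e * (\<i> * tangent s0))"
      unfolding case_prod_unfold
      by (intro continuous_intros continuous_on_compose2[OF continuous_g]) (use cd in auto)
    show "connected ({c..d} \<times> {-b..<0})"
      by (intro connected_Times) auto
  qed
  moreover have "?V \<subseteq> ball 0 1 - curve_in_disk g"
    unfolding disk_minus_curve using strip by force
  moreover have "D \<inter> ?V \<noteq> {}" using inD s e by force
  ultimately have V: "?V \<subseteq> D"
    by (rule components_maximal[OF D_component])
  have "ball (g s0) r \<subseteq> D \<union> path_image g"
  proof
    fix w assume "w \<in> ball (g s0) r"
    from cover[OF this] obtain s e where se: "s \<in> {c<..<d}" "\<bar>e\<bar> < b" "w = g s + of_real e * (\<i> * tangent s0)" by blast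
    consider "e < 0" | "e = 0" | "e > 0" by linarith
    then show "w \<in> D \<union> path_image g"
    proof cases
      case 1
      then have "w \<in> ?V" using se by force
      then show ?thesis using V by blast
    next
      case 2
      then show ?thesis using se cd by (auto simp: path_image_def)
    next
      case 3
      then show ?thesis
        using strip_above[OF s0 cd(2,3) b strip cd(1,4), of s e] se by auto
    qed
  qed
  then show ?thesis
    using r by (meson centre_in_ball interiorI open_ball)
qed

text \<open>Otherwise \<open>D\<close> would lie on both sides of the whole curve, and the other component of the
  complement would be the disk without at most two points.\<close>

lemma curve_not_interior:
  assumes "s \<in> {0<..<1}"
  shows "g s \<notin> interior (D \<union> path_image g)"
proof -
  define R where "R = {0<..<1} \<inter> g -` interior (D \<union> path_image g)"
  have oR: "open R"
    unfolding R_def by (intro continuous_open_preimage continuous_on_subset[OF continuous_g]) auto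
  \<comment> \<open>If s0 is not in R, the lower half of its strip misses D. Every neighbourhood of
    a nearby \<open>g s\<close> reaches that half, so s is not in R either. As R is open too,
    connectedness leaves R empty or everything.\<close>
  have oRc: "open ({0<..<1} - R)"
    unfolding open_subopen[of "{0<..<1} - R"]
  proof
    fix s0 assume s0: "s0 \<in> {0<..<1} - R"
    then have s0': "s0 \<in> {0<..<1}" by simp
    obtain c d b r where st: "0 < c" "c < s0" "s0 < d" "d < 1" "0 < b" "0 < r"
      and ball: "ball (g s0) r \<subseteq> ball 0 1"
      and strip: "\<And>s e. s \<in> {c..d} \<Longrightarrow> \<bar>e\<bar> \<le> b \<Longrightarrow> e \<noteq> 0 \<Longrightarrow> g s + of_real e * (\<i> * tangent s0) \<in> ball 0 1 - path_image g"
      and cover: "\<And>w. w \<in> ball (g s0) r \<Longrightarrow> \<exists>s\<in>{c<..<d}. \<exists>e. \<bar>e\<bar> < b \<and> w = g s + of_real e * (\<i> * tangent s0)"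
      using local_strip[OF s0'] by metis
    have below: "g s + of_real e * (\<i> * tangent s0) \<notin> D" if "s \<in> {c..d}" "e \<in> {-b..<0}" for s e
      using strip_below_imp_interior[OF s0' st strip cover that] s0 by (auto simp: R_def)
    have "g s \<notin> interior (D \<union> path_image g)" if s: "s \<in> {c<..<d}" for s
    proof
      assume "g s \<in> interior (D \<union> path_image g)"
      moreover have "((\<lambda>e. g s + of_real e * (\<i> * tangent s0)) \<longlongrightarrow> g s + of_real 0 * (\<i> * tangent s0)) (at_left 0)"
        by (intro tendsto_intros)
      ultimately have "\<forall>\<^sub>F e in at_left 0. g s + of_real e * (\<i> * tangent s0) \<in> interior (D \<union> path_image g)"
        by (intro topological_tendstoD) auto
      moreover have "\<forall>\<^sub>F e in at_left 0. e \<in> {-b..<0}"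
        using st by (auto simp: eventually_at_left_field intro!: exI[of _ "-b"])
      ultimately have "\<forall>\<^sub>F e in at_left 0. g s + of_real e * (\<i> * tangent s0) \<in> interior (D \<union> path_image g) \<and> e \<in> {-b..<0}"
        by (rule eventually_conj)
      then obtain e where e: "g s + of_real e * (\<i> * tangent s0) \<in> interior (D \<union> path_image g)" "e \<in> {-b..<0}"
        using eventually_happens trivial_limit_at_left_real by blast
      then have "g s + of_real e * (\<i> * tangent s0) \<in> D \<union> path_image g"
        using interior_subset by blast
      moreover have "g s + of_real e * (\<i> * tangent s0) \<notin> path_image g"
        using strip[of s e] s e by auto
      moreover have "g s + of_real e * (\<i> * tangent s0) \<notin> D"
        using below[of s e] s e by auto
      ultimately show False by blast
    qed
    then show "\<exists>U. open U \<and> s0 \<in> U \<and> U \<subseteq> {0<..<1} - R"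
      using st by (intro exI[of _ "{c<..<d}"]) (auto simp: R_def)
  qed
  have "R \<inter> {0<..<1} = {} \<or> ({0<..<1} - R) \<inter> {0<..<1} = {}"
    by (rule connectedD[OF _ oR oRc]) auto
  moreover have False if all: "{0<..<1} \<subseteq> R"
  proof -
    obtain D' where D': "D' \<in> components (ball 0 1 - path_image g)" "D' \<noteq> D"
      using two_components unfolding disk_minus_curve card_2_iff by blast
    define W where "W = ball 0 1 - {g 0, g 1}"
    have "connected W"
      unfolding W_def by (intro connected_open_delete_finite) auto
    have ends: "g 0 \<in> path_image g" "g 1 \<in> path_image g"
      by (auto simp: path_image_def)
    \<comment> \<open>Near a point of \<Gamma> other than its end points only D and \<Gamma> would
      occur, so D' is relatively closed in W as well as open and fills the connected set W.\<close>
    have "open (W - D')"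
      unfolding open_subopen[of "W - D'"]
    proof
      fix x assume x: "x \<in> W - D'"
      have oW: "open W" by (auto simp: W_def intro!: open_Diff)
      show "\<exists>U. open U \<and> x \<in> U \<and> U \<subseteq> W - D'"
      proof (cases "x \<in> path_image g")
        case True
        then obtain s where s: "s \<in> {0..1}" "x = g s" by (auto simp: path_image_def)
        with x have "s \<noteq> 0" "s \<noteq> 1" by (auto simp: W_def)
        with s have "s \<in> R"
          by (intro subsetD[OF all]) auto
        then have "x \<in> interior (D \<union> path_image g)"
          by (simp add: R_def s)
        moreover have "D \<inter> D' = {}"
          using components_nonoverlap D' D_component disk_minus_curve by metis
        moreover have "D' \<inter> path_image g = {}"
          using in_components_subset[OF D'(1)] by blast
        ultimately show ?thesis
          using oW x interior_subset[of "D \<union> path_image g"]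
          by (intro exI[of _ "W \<inter> interior (D \<union> path_image g)"]) auto
      next
        case False
        then have "x \<in> \<Union>(components (ball 0 1 - path_image g))"
          using x by (simp add: W_def)
        then obtain C where C: "C \<in> components (ball 0 1 - path_image g)" "x \<in> C" by blast
        then have "C \<inter> D' = {}"
          using components_nonoverlap D' x by blast
        moreover have "open C"
          using open_components open_disk_minus_curve C by blast
        moreover have "C \<subseteq> W"
          using in_components_subset[OF C(1)] ends by (auto simp: W_def)
        ultimately show ?thesis using C by blast
      qed
    qed
    moreover have "open D'"
      using open_components open_disk_minus_curve D' by blast
    moreover have D'W: "D' \<subseteq> W"
      using in_components_subset[OF D'(1)] ends by (auto simp: W_def)
    ultimately have "D' \<inter> W = {} \<or> (W - D') \<inter> W = {}"
      by (intro connectedD[OF \<open>connected W\<close>]) auto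
    moreover have "D' \<noteq> {}" using D' in_components_nonempty by blast
    ultimately have "W \<subseteq> D'" using D'W by blast
    moreover have "g (1/2) \<in> W"
      using in_ball[of "1/2"] g_eq_interior[of "1/2" 0] g_eq_interior[of "1/2" 1] by (auto simp: W_def)
    moreover have "g (1/2) \<in> path_image g" by (auto simp: path_image_def)
    ultimately show False using in_components_subset[OF D'(1)] by blast
  qed
  ultimately show ?thesis using assms by (auto simp: R_def)
qed

end

section \<open>Holomorphic extension of the jump function\<close>

text \<open>Two local extensions agree off P, hence on the overlap of their discs by continuity, as
  the complement of P is dense. Thus the diagonal choice \<open>H p = E p p\<close> coincides near p
  with the holomorphic function \<open>E p\<close>.\<close>

lemma holomorphic_glue:
  fixes h :: "complex \<Rightarrow> complex"
  assumes U: "open U" and dense: "U \<subseteq> closure (- P)"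
    and loc: "\<And>p. p \<in> U \<Longrightarrow> \<exists>r>0. \<exists>E. E holomorphic_on ball p r \<and> (\<forall>w\<in>ball p r - P. E w = h w)"
  obtains H where "H holomorphic_on U" "\<And>w. w \<in> U - P \<Longrightarrow> H w = h w"
proof -
  obtain r E where rE: "\<And>p. p \<in> U \<Longrightarrow> 0 < r p" "\<And>p. p \<in> U \<Longrightarrow> E p holomorphic_on ball p (r p)"
      "\<And>p w. p \<in> U \<Longrightarrow> w \<in> ball p (r p) - P \<Longrightarrow> E p w = h w"
    using loc by metis
  define H where "H p = E p p" for p
  have same: "H w = E p w" if p: "p \<in> U" and w: "w \<in> ball p (r p) \<inter> U" for p w
  proof (rule ccontr)
    assume neq: "H w \<noteq> E p w"
    define N where "N = ball w (r w) \<inter> ball p (r p)"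
    have "open (N \<inter> (\<lambda>x. E w x - E p x) -` (- {0}))"
    proof (rule continuous_open_preimage)
      show "continuous_on N (\<lambda>x. E w x - E p x)"
        using rE(2)[of w] rE(2)[of p] p w unfolding N_def
        by (intro continuous_intros) (auto intro: holomorphic_on_imp_continuous_on continuous_on_subset)
    qed (auto simp: N_def)
    moreover have "w \<in> N \<inter> (\<lambda>x. E w x - E p x) -` (- {0})"
      using neq rE(1) w by (simp add: N_def H_def)
    moreover have "w \<in> closure (- P)" using dense w by blast
    ultimately have "N \<inter> (\<lambda>x. E w x - E p x) -` (- {0}) \<inter> - P \<noteq> {}"
      using open_Int_closure_eq_empty by blast
    then obtain x where "x \<in> N \<inter> (\<lambda>x. E w x - E p x) -` (- {0}) \<inter> - P" by blast
    then have "x \<in> N" "x \<notin> P" "E w x \<noteq> E p x" by auto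
    then show False
      using rE(3)[of w x] rE(3)[of p x] p w by (auto simp: N_def)
  qed
  show thesis
  proof
    show "H holomorphic_on U"
      unfolding holomorphic_on_open[OF U]
    proof
      fix p assume p: "p \<in> U"
      have N: "open (ball p (r p) \<inter> U)" "p \<in> ball p (r p) \<inter> U" using U rE(1) p by auto
      have "(E p has_field_derivative deriv (E p) p) (at p)"
        using rE(1,2)[OF p] by (intro holomorphic_derivI[of _ "ball p (r p)"]) auto
      then have "(H has_field_derivative deriv (E p) p) (at p)"
        by (rule has_field_derivative_transform_within_open[OF _ N]) (rule same[OF p, symmetric])
      then show "\<exists>f'. (H has_field_derivative f') (at p)" by blast
    qed
    show "H w = h w" if "w \<in> U - P" for w
      using rE(1,3)[of w] that by (simp add: H_def)
  qed
qed

section \<open>The jump of the Cauchy integral across \<Gamma>\<close>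

locale lune_function = lune_domain +
  fixes u :: "complex \<Rightarrow> complex"
  assumes hol_u: "u holomorphic_on D" and cont_u: "continuous_on (closure D) u"
begin

definition C :: "complex \<Rightarrow> complex" where
  "C w = 1 / (2 * of_real pi * \<i>) * contour_integral g (\<lambda>\<zeta>. u \<zeta> / (\<zeta> - w))"

text \<open>The values on \<Gamma> carry no meaning, since the integral in C need not exist there; h
  matters off \<open>path_image g\<close> only.\<close>

definition h :: "complex \<Rightarrow> complex" where "h w = C w - (if w \<in> D then u w else 0)"

text \<open>This makes u continuous along the whole path. Interior points are approached from D
  along their left normals, the end points by continuity of g.\<close>

lemma curve_in_closure: "path_image g \<subseteq> closure D"
proof -
  have "g ` {0<..<1} \<subseteq> closure D"
  proof clarify
    fix s :: real assume s: "s \<in> {0<..<1}"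
    have "((\<lambda>e. g s + of_real e * (\<i> * tangent s)) \<longlongrightarrow> g s + of_real 0 * (\<i> * tangent s)) (at_right 0)"
      by (intro tendsto_intros)
    moreover have "\<forall>\<^sub>F e in at_right 0. g s + of_real e * (\<i> * tangent s) \<in> closure D"
      using left[OF s] by (rule eventually_mono) (use closure_subset in blast)
    ultimately have "g s + of_real 0 * (\<i> * tangent s) \<in> closure D"
      by (intro Lim_in_closed_set) auto
    then show "g s \<in> closure D" by simp
  qed
  then have "g ` closure {0<..<1} \<subseteq> closure D"
    by (intro image_closure_subset) (auto simp: continuous_g)
  then show ?thesis by (simp add: path_image_def)
qed

lemma continuous_ug: "continuous_on {0..1} (\<lambda>s. u (g s))"
  by (rule continuous_on_compose2[OF cont_u continuous_g]) (use curve_in_closure in \<open>auto simp: path_image_def\<close>)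

lemma C_integral: "C w = 1 / (2 * of_real pi * \<i>) * integral {0..1} (\<lambda>s. (u (g s) * tangent s) / (g s - w))"
  unfolding C_def contour_integral_integral tangent_def by simp

lemma C_holomorphic: "C holomorphic_on (- path_image g)"
proof -
  have "(\<lambda>w. 1 / (2 * of_real pi * \<i>) * integral {0..1} (\<lambda>s. (u (g s) * tangent s) / (g s - w))) holomorphic_on (- path_image g)"
    by (intro holomorphic_intros Cauchy_type_integral_holomorphic continuous_g continuous_on_mult
          continuous_ug continuous_tangent) (use closed_path_image_g in \<open>auto simp: path_image_def\<close>)
  then show ?thesis by (simp add: C_integral[abs_def])
qed

lemma ball_in_or_out:
  assumes "ball p r \<subseteq> ball 0 1 - path_image g"
  shows "ball p r \<subseteq> D \<or> ball p r \<inter> D = {}"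
  using components_maximal[OF D_component, of "ball p r"] assms disk_minus_curve by auto

lemma extension_off_curve:
  assumes "p \<in> ball 0 1 - path_image g"
  shows "\<exists>r>0. \<exists>E. E holomorphic_on ball p r \<and> (\<forall>w\<in>ball p r - path_image g. E w = h w)"
proof -
  obtain r where r: "0 < r" "ball p r \<subseteq> ball 0 1 - path_image g"
    using assms open_disk_minus_curve openE by blast
  have C: "C holomorphic_on ball p r"
    using C_holomorphic r by (rule_tac holomorphic_on_subset) auto
  from ball_in_or_out[OF r(2)] show ?thesis
  proof
    assume D: "ball p r \<subseteq> D"
    then have "(\<lambda>w. C w - u w) holomorphic_on ball p r"
      using C hol_u by (intro holomorphic_intros) (auto intro: holomorphic_on_subset)
    then show ?thesis
      using r D by (intro exI[of _ r]) (auto simp: h_def intro!: exI[of _ "\<lambda>w. C w - u w"])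
  next
    assume D: "ball p r \<inter> D = {}"
    then show ?thesis
      using r C by (intro exI[of _ r]) (auto simp: h_def intro!: exI[of _ C])
  qed
qed

text \<open>In the Cauchy integral the piece of \<Gamma> over \<open>{c..d}\<close> is exchanged for
  the other three sides of the strip above it. The new contour avoids a disc around
  \<open>g s0\<close>, so its integral E is holomorphic there. For w inside the strip the exchange
  costs \<open>u w\<close>, for w below it nothing: exactly the jump removed in h.\<close>

lemma extension_across_curve:
  assumes s0: "s0 \<in> {0<..<1}"
  shows "\<exists>r>0. \<exists>E. E holomorphic_on ball (g s0) r \<and> (\<forall>w\<in>ball (g s0) r - path_image g. E w = h w)"
proof -
  obtain c d b r where cd: "0 < c" "c < s0" "s0 < d" "d < 1" and b: "0 < b" and r: "0 < r"
    and mono: "strict_mono_on {c..d} (\<lambda>s. Re (g s / tangent s0))"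
    and ball: "ball (g s0) r \<subseteq> ball 0 1"
    and strip: "\<And>s e. s \<in> {c..d} \<Longrightarrow> \<bar>e\<bar> \<le> b \<Longrightarrow> e \<noteq> 0 \<Longrightarrow> g s + of_real e * (\<i> * tangent s0) \<in> ball 0 1 - path_image g"
    and cover: "\<And>w. w \<in> ball (g s0) r \<Longrightarrow> \<exists>s\<in>{c<..<d}. \<exists>e. \<bar>e\<bar> < b \<and> w = g s + of_real e * (\<i> * tangent s0)"
    using local_strip[OF s0] by metis
  define v where "v = \<i> * tangent s0"
  have T0: "tangent s0 \<noteq> 0" using tangent_nonzero s0 by auto
  then have v0: "v \<noteq> 0" by (simp add: v_def)
  have cd': "c < d" "{c..d} \<subseteq> {0..1}" using cd by auto
  have uniq: "s = s' \<and> e = e'" if "g s + of_real e * v = g s' + of_real e' * v" "s \<in> {c..d}" "s' \<in> {c..d}" for s s' e e'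
  proof -
    have "g s / tangent s0 + of_real e * \<i> = g s' / tangent s0 + of_real e' * \<i>"
      using that(1) T0 by (simp add: v_def field_simps)
    then have "Re (g s / tangent s0 + of_real e * \<i>) = Re (g s' / tangent s0 + of_real e' * \<i>)" by (rule arg_cong)
    then have "Re (g s / tangent s0) = Re (g s' / tangent s0)" by simp
    then have "s = s'"
      using mono that(2,3) unfolding strict_mono_on_def
      by (metis less_irrefl linorder_less_linear)
    with that(1) v0 show ?thesis by auto
  qed
  have above: "g s + of_real e * v \<in> D" if "s \<in> {c..d}" "e \<in> {0<..b}" for s e
    unfolding v_def using strip_above[OF s0 cd(2,3) b strip cd(1,4)] that by blast
  \<comment> \<open>The orientation condition is silent about this side; the number of components
    enters here through \<open>curve_not_interior\<close>.\<close>
  have below: "g s + of_real e * v \<notin> D" if "s \<in> {c..d}" "e < 0" "-b \<le> e" for s e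
    using strip_below_imp_interior[OF s0 cd b r strip cover that(1), of e] that(2,3) curve_not_interior[OF s0]
    by (auto simp: v_def)
  define K where "K = (\<lambda>(s, e). g s + of_real e * v) ` ({c..d} \<times> {0..b})"
  have KD: "K \<subseteq> closure D"
  proof -
    have "g s + of_real e * v \<in> closure D" if "s \<in> {c..d}" "e \<in> {0..b}" for s e
    proof (cases "e = 0")
      case True
      then show ?thesis using curve_in_closure that cd by (auto simp: path_image_def)
    next
      case False
      then show ?thesis using above[of s e] that closure_subset by force
    qed
    then show ?thesis by (auto simp: K_def)
  qed
  have uK: "continuous_on K u"
    using cont_u KD continuous_on_subset by blast
  have inK: "g s + of_real e * v \<in> K" if "s \<in> {c..d}" "e \<in> {0..b}" for s e
    using that unfolding K_def by force
  have cgcd: "continuous_on {c..d} g" and cTcd: "continuous_on {c..d} tangent"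
    using continuous_g continuous_tangent cd' continuous_on_subset by blast+
  have top_u: "continuous_on {c..d} (\<lambda>s. u (g s + of_real b * v))"
    by (rule continuous_on_compose2[OF uK]) (use inK b in \<open>auto intro!: continuous_intros cgcd\<close>)
  have side_u: "continuous_on {0..b} (\<lambda>e. u (g s + of_real e * v))" if "s \<in> {c..d}" for s
    by (rule continuous_on_compose2[OF uK]) (use inK that in \<open>auto intro!: continuous_intros\<close>)
  define E where "E w = 1 / (2 * of_real pi * \<i>) *
     (integral {0..c} (\<lambda>s. (u (g s) * tangent s) / (g s - w)) + integral {d..1} (\<lambda>s. (u (g s) * tangent s) / (g s - w))
      + integral {c..d} (\<lambda>s. (u (g s + of_real b * v) * tangent s) / (g s + of_real b * v - w))
      - (integral {0..b} (\<lambda>e. (v * u (g d + of_real e * v)) / (g d + of_real e * v - w))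
         - integral {0..b} (\<lambda>e. (v * u (g c + of_real e * v)) / (g c + of_real e * v - w))))" for w
  let ?B = "ball (g s0) r"
  \<comment> \<open>The disc is covered by the open strip, whose coordinates (s, e) are unique.
    Hence it contains no point of the upper edge or of the lateral sides, and the rest of \<Gamma>
    could enter only at \<open>e = 0\<close>, which simplicity of the path excludes.\<close>
  have avoid_rest: "g s \<notin> ?B" if s: "s \<in> {0..c} \<or> s \<in> {d..1}" for s
  proof
    assume "g s \<in> ?B"
    from cover[OF this] obtain s' e where se: "s' \<in> {c<..<d}" "\<bar>e\<bar> < b" "g s = g s' + of_real e * v"
      unfolding v_def by blast
    have s01: "s \<in> {0..1}" using s cd by auto
    have "e = 0"
    proof (rule ccontr)
      assume "e \<noteq> 0"
      with strip[of s' e] se have "g s \<notin> path_image g" by (auto simp: v_def)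
      then show False using s01 by (auto simp: path_image_def)
    qed
    then have "s = s'" using g_eq_interior[of s' s] se s01 cd by auto
    then show False using se s by auto
  qed
  have avoid_top: "g s + of_real b * v \<notin> ?B" if s: "s \<in> {c..d}" for s
  proof
    assume "g s + of_real b * v \<in> ?B"
    from cover[OF this] obtain s' e where "s' \<in> {c<..<d}" "\<bar>e\<bar> < b" "g s + of_real b * v = g s' + of_real e * v"
      unfolding v_def by blast
    then show False using uniq[of s b s' e] s by auto
  qed
  have avoid_side: "g s + of_real e * v \<notin> ?B" if s: "s = c \<or> s = d" for s e
  proof
    assume "g s + of_real e * v \<in> ?B"
    from cover[OF this] obtain s' e' where "s' \<in> {c<..<d}" "\<bar>e'\<bar> < b" "g s + of_real e * v = g s' + of_real e' * v"
      unfolding v_def by blast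
    then show False using uniq[of s e s' e'] s cd' by auto
  qed
  have cont: "continuous_on A (\<lambda>s. u (g s) * tangent s)" "continuous_on A g" if "A \<subseteq> {0..1}" for A
    using continuous_on_mult[OF continuous_ug continuous_tangent] continuous_g continuous_on_subset that by blast+
  have "E holomorphic_on ?B"
    unfolding E_def
    by (intro holomorphic_intros Cauchy_type_integral_holomorphic cont continuous_intros top_u side_u
          cgcd cTcd open_ball) (use cd avoid_rest avoid_top avoid_side in auto)
  moreover have "E w = h w" if w: "w \<in> ?B - path_image g" for w
  proof -
    obtain sw ew where sw: "sw \<in> {c<..<d}" and ew: "\<bar>ew\<bar> < b" and weq: "w = g sw + of_real ew * v"
      using cover[of w] w unfolding v_def by blast
    have ew0: "ew \<noteq> 0"
      using w sw cd weq by (auto simp: path_image_def)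
    have int01: "(\<lambda>s. (u (g s) * tangent s) / (g s - w)) integrable_on A" if "A = {0..1} \<or> A = {0..d}" for A
    proof -
      have "(\<lambda>s. (u (g s) * tangent s) / (g s - w)) integrable_on {0..1}"
        by (intro integrable_continuous_real continuous_intros cont(1) continuous_g)
           (use w in \<open>auto simp: path_image_def\<close>)
      then show ?thesis
        using that cd integrable_on_subinterval[of _ "{0..1}" 0 d] by auto
    qed
    have split: "integral {0..1} (\<lambda>s. (u (g s) * tangent s) / (g s - w)) =
        integral {0..c} (\<lambda>s. (u (g s) * tangent s) / (g s - w)) + integral {c..d} (\<lambda>s. (u (g s) * tangent s) / (g s - w))
        + integral {d..1} (\<lambda>s. (u (g s) * tangent s) / (g s - w))"
      using Henstock_Kurzweil_Integration.integral_combine[of 0 d 1, OF _ _ int01]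
        Henstock_Kurzweil_Integration.integral_combine[of 0 c d, OF _ _ int01] cd by simp
    have hasT: "(g has_vector_derivative tangent s) (at s within {c..d})" if "s \<in> {c..d}" for s
      using has_tangent[of s] that cd' has_vector_derivative_at_within by blast
    have sides: "integral {0..b} (\<lambda>e. v * (u (g d + of_real e * v) / (g d + of_real e * v - w)
                                       - u (g c + of_real e * v) / (g c + of_real e * v - w)))
        = integral {0..b} (\<lambda>e. (v * u (g d + of_real e * v)) / (g d + of_real e * v - w))
         - integral {0..b} (\<lambda>e. (v * u (g c + of_real e * v)) / (g c + of_real e * v - w))"
    proof -
      have ne: "g s + of_real e * v - w \<noteq> 0" if "s = c \<or> s = d" for s e
        using avoid_side[OF that, of e] w by auto
      have "integral {0..b} (\<lambda>e. (v * u (g d + of_real e * v)) / (g d + of_real e * v - w)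
           - (v * u (g c + of_real e * v)) / (g c + of_real e * v - w))
        = integral {0..b} (\<lambda>e. (v * u (g d + of_real e * v)) / (g d + of_real e * v - w))
         - integral {0..b} (\<lambda>e. (v * u (g c + of_real e * v)) / (g c + of_real e * v - w))"
        by (intro integral_diff integrable_continuous_real continuous_intros side_u)
           (use ne cd' in auto)
      then show ?thesis by (simp add: right_diff_distrib)
    qed
    have jump: "integral {c..d} (\<lambda>s. (u (g s) * tangent s) / (g s - w)) =
        integral {c..d} (\<lambda>s. (u (g s + of_real b * v) * tangent s) / (g s + of_real b * v - w))
        - integral {0..b} (\<lambda>e. v * (u (g d + of_real e * v) / (g d + of_real e * v - w)
                                       - u (g c + of_real e * v) / (g c + of_real e * v - w)))
        + (if w \<in> D then 2 * of_real pi * \<i> * u w else 0)"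
    proof (cases "0 < ew")
      case True
      then have "w \<in> D" using above[of sw ew] sw ew weq by auto
      moreover have "integral {c..d} (\<lambda>s. u (g s) / (g s - w) * tangent s)
       - integral {c..d} (\<lambda>s. u (g s + of_real b * v) / (g s + of_real b * v - w) * tangent s)
       + integral {0..b} (\<lambda>e. v * (u (g d + of_real e * v) / (g d + of_real e * v - w)
                                       - u (g c + of_real e * v) / (g c + of_real e * v - w)))
       = 2 * of_real pi * \<i> * u w"
        unfolding v_def
      proof (rule strip_Cauchy_formula[OF cd'(1) b T0 hasT cTcd mono open_D hol_u _ _ sw])
        show "g s + of_real e * (\<i> * tangent s0) \<in> D" if "s \<in> {c..d}" "e \<in> {0<..<b}" for s e
          using above[of s e] that by (simp add: v_def)
        show "continuous_on ((\<lambda>(s, e). g s + of_real e * (\<i> * tangent s0)) ` ({c..d} \<times> {0..b})) u"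
          using uK by (simp add: K_def v_def)
      qed (use True ew weq in \<open>auto simp: v_def\<close>)
      ultimately show ?thesis by (simp add: algebra_simps)
    next
      \<comment> \<open>For w below \<Gamma> the pole lies outside the closed strip, so Cauchy's
        theorem applies without a residue.\<close>
      case False
      then have nD: "w \<notin> D" using below[of sw ew] sw ew weq ew0 by auto
      have neK: "z \<noteq> w" if "z \<in> K" for z
      proof
        assume "z = w"
        with that obtain s e where "s \<in> {c..d}" "e \<in> {0..b}" "g s + of_real e * v = g sw + of_real ew * v"
          unfolding K_def weq by auto
        with uniq[of s e sw ew] sw ew0 False show False by auto
      qed
      have "integral {c..d} (\<lambda>s. u (g s + of_real b * v) / (g s + of_real b * v - w) * tangent s)
          - integral {c..d} (\<lambda>s. u (g s) / (g s - w) * tangent s)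
          = integral {0..b} (\<lambda>e. v * (u (g d + of_real e * v) / (g d + of_real e * v - w)
                                       - u (g c + of_real e * v) / (g c + of_real e * v - w)))"
      proof (rule strip_Cauchy[OF less_imp_le[OF cd'(1)] b hasT cTcd open_D])
        show "(\<lambda>z. u z / (z - w)) holomorphic_on D"
          using nD by (intro holomorphic_intros hol_u) auto
        show "continuous_on ((\<lambda>(s, e). g s + of_real e * v) ` ({c..d} \<times> {0..b})) (\<lambda>z. u z / (z - w))"
          unfolding K_def[symmetric] using neK by (intro continuous_intros uK) auto
      qed (use above in auto)
      with nD show ?thesis by (simp add: algebra_simps)
    qed
    show "E w = h w"
      unfolding E_def h_def C_integral split jump sides
      by (simp add: algebra_simps add_divide_distrib diff_divide_distrib)
  qed
  ultimately show ?thesis using r by blast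
qed

end

section \<open>Removal of the end point singularities\<close>

lemma compact_norm_bound:
  fixes f :: "'a::topological_space \<Rightarrow> 'b::real_normed_vector"
  assumes "continuous_on S f" "compact S"
  obtains B where "\<And>x. x \<in> S \<Longrightarrow> norm (f x) \<le> B"
  using compact_imp_bounded[OF compact_continuous_image[OF assms]] by (auto simp: bounded_iff)

context lune_function
begin

text \<open>\<Gamma> lies in the closure of D and D misses \<Gamma>. This is the density that gluing
  needs.\<close>

lemma closure_compl_curve: "closure (- path_image g) = UNIV"
proof -
  have "closure D \<subseteq> closure (- path_image g)"
    using D_subset by (intro closure_mono) auto
  then show ?thesis
    using curve_in_closure closure_subset[of "- path_image g"] by blast
qed

text \<open>h differs from C by at most the maximum of \<open>norm u\<close>, and
  \<open>1 / (2 * pi) \<le> 1\<close>; one M bounds both u and the density. The integral of the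
  kernel is left unevaluated, which is the form that \<open>Cauchy_bounded_singularity\<close> asks
  for.\<close>

lemma h_bound:
  obtains M where "0 \<le> M" "\<And>w. w \<notin> path_image g \<Longrightarrow> ennreal (norm (h w)) \<le>
      ennreal M * (1 + (\<integral>\<^sup>+s. inverse (ennreal (norm (g s - w))) * indicator {0..1} s \<partial>lborel))"
proof -
  have "bounded D"
    using D_subset bounded_subset[of "ball 0 1" D] by auto
  then obtain B1 where B1: "\<And>z. z \<in> closure D \<Longrightarrow> norm (u z) \<le> B1"
    using compact_norm_bound[OF cont_u] by auto
  obtain B2 where B2: "\<And>s. s \<in> {0..1} \<Longrightarrow> norm (u (g s) * tangent s) \<le> B2"
    using compact_norm_bound[OF continuous_on_mult[OF continuous_ug continuous_tangent]] by auto
  define M where "M = max 0 (max B1 B2)"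
  have M: "0 \<le> M" "\<And>z. z \<in> closure D \<Longrightarrow> norm (u z) \<le> M" "\<And>s. s \<in> {0..1} \<Longrightarrow> norm (u (g s) * tangent s) \<le> M"
    using B1 B2 by (fastforce simp: M_def)+
  show ?thesis
  proof (rule that[OF M(1)])
    fix w assume w: "w \<notin> path_image g"
    let ?I = "\<integral>\<^sup>+s. inverse (ennreal (norm (g s - w))) * indicator {0..1} s \<partial>lborel"
    let ?f = "\<lambda>s. (u (g s) * tangent s) / (g s - w)"
    define gI where "gI s = indicator {0..1} s *\<^sub>R g s" for s :: real
    have [measurable]: "gI \<in> borel_measurable borel"
      unfolding gI_def by (intro borel_measurable_continuous_on_indicator continuous_g) auto
    have ne: "g s \<noteq> w" if "s \<in> {0..1}" for s
      using that w by (auto simp: path_image_def)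
    have "norm (C w) \<le> norm (integral {0..1} ?f)"
    proof -
      have "1 * norm (integral {0..1} ?f) \<le> 2 * pi * norm (integral {0..1} ?f)"
        using pi_ge_two by (intro mult_right_mono) auto
      then show ?thesis
        by (simp add: C_integral norm_mult norm_divide field_simps)
    qed
    then have "ennreal (norm (C w)) \<le> ennreal (norm (integral {0..1} ?f))"
      by (rule ennreal_leI)
    also have "\<dots> \<le> (\<integral>\<^sup>+s. ennreal (norm (?f s)) * indicator {0..1} s \<partial>lborel)"
      by (intro ennreal_norm_integral_le continuous_intros continuous_ug continuous_tangent continuous_g) (use ne in auto)
    also have "\<dots> \<le> (\<integral>\<^sup>+s. ennreal M * (inverse (ennreal (norm (gI s - w))) * indicator {0..1} s) \<partial>lborel)"
    proof (intro nn_integral_mono)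
      fix s
      show "ennreal (norm (?f s)) * indicator {0..1} s \<le> ennreal M * (inverse (ennreal (norm (gI s - w))) * indicator {0..1} s)"
      proof (cases "s \<in> {0..1}")
        case True
        have "norm (?f s) \<le> M / norm (g s - w)"
          unfolding norm_divide by (intro divide_right_mono M(3) True norm_ge_zero)
        also have "\<dots> = M * inverse (norm (g s - w))"
          by (rule divide_inverse)
        finally have "norm (?f s) \<le> M * inverse (norm (g s - w))" .
        then show ?thesis
          using True ne[OF True] M(1)
          by (simp add: gI_def inverse_ennreal ennreal_mult[symmetric] ennreal_leI)
      qed simp
    qed
    also have "\<dots> = ennreal M * (\<integral>\<^sup>+s. inverse (ennreal (norm (gI s - w))) * indicator {0..1} s \<partial>lborel)"
      by (intro nn_integral_cmult) measurable
    also have "(\<integral>\<^sup>+s. inverse (ennreal (norm (gI s - w))) * indicator {0..1} s \<partial>lborel) = ?I"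
      by (intro nn_integral_cong) (simp add: gI_def split: split_indicator)
    finally have C: "ennreal (norm (C w)) \<le> ennreal M * ?I" .
    have "norm (h w) \<le> norm (C w) + M"
      using M(1) M(2)[of w] closure_subset[of D] norm_triangle_ineq4[of "C w" "u w"]
      by (auto simp: h_def)
    then have "ennreal (norm (h w)) \<le> ennreal (norm (C w) + M)"
      by (rule ennreal_leI)
    also have "\<dots> = ennreal (norm (C w)) + ennreal M"
      using M by (simp add: ennreal_plus)
    also have "\<dots> \<le> ennreal M * ?I + ennreal M"
      by (intro add_right_mono C)
    also have "\<dots> = ennreal M * (1 + ?I)"
      by (simp add: distrib_left add.commute)
    finally show "ennreal (norm (h w)) \<le> ennreal M * (1 + ?I)" .
  qed
qed

text \<open>Gluing is done twice: first away from the end points, where strips exist; then the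
  function so obtained, with a singularity removed, itself serves as the local extension at an end
  point.\<close>

lemma holomorphic_extension:
  obtains H where "H holomorphic_on ball 0 1" "\<And>w. w \<in> ball 0 1 - path_image g \<Longrightarrow> H w = h w"
proof -
  have loc: "\<exists>r>0. \<exists>E. E holomorphic_on ball p r \<and> (\<forall>w\<in>ball p r - path_image g. E w = h w)"
    if p: "p \<in> ball 0 1 - {g 0, g 1}" for p
  proof (cases "p \<in> path_image g")
    case True
    then obtain s where s: "s \<in> {0..1}" "p = g s" by (auto simp: path_image_def)
    with p have "s \<noteq> 0" "s \<noteq> 1" by auto
    with s have "s \<in> {0<..<1}" by auto
    from extension_across_curve[OF this] show ?thesis by (simp add: s)
  qed (use p extension_off_curve in auto)
  have "open (ball 0 1 - {g 0, g 1})"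
    by (intro open_Diff) auto
  then obtain H0 where H0: "H0 holomorphic_on ball 0 1 - {g 0, g 1}"
      "\<And>w. w \<in> (ball 0 1 - {g 0, g 1}) - path_image g \<Longrightarrow> H0 w = h w"
    by (rule holomorphic_glue[of _ "path_image g" h]) (use loc closure_compl_curve in auto)
  obtain M where M: "0 \<le> M" "\<And>w. w \<notin> path_image g \<Longrightarrow> ennreal (norm (h w)) \<le>
      ennreal M * (1 + (\<integral>\<^sup>+s. inverse (ennreal (norm (g s - w))) * indicator {0..1} s \<partial>lborel))"
    using h_bound by blast
  have ends: "g 0 \<in> path_image g" "g 1 \<in> path_image g"
    by (auto simp: path_image_def)
  have loc': "\<exists>r>0. \<exists>E. E holomorphic_on ball p r \<and> (\<forall>w\<in>ball p r - path_image g. E w = h w)"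
    if p: "p \<in> ball 0 1" for p
  proof (cases "p \<in> {g 0, g 1}")
    case True
    \<comment> \<open>Only the other end point is taken out, so that \<open>S - {p}\<close> is the
      domain of H0 whether or not the two end points coincide.\<close>
    define S where "S = ball 0 1 - ({g 0, g 1} - {p})"
    have S: "open S" "p \<in> S" "S - {p} = ball 0 1 - {g 0, g 1}"
      using p True by (auto simp: S_def intro!: open_Diff finite_imp_closed)
    have "((\<lambda>w. (w - p) * H0 w) \<longlongrightarrow> 0) (at p)"
    proof (rule Cauchy_bounded_singularity[OF S(1,2) _ _ _ M(1)])
      show "H0 holomorphic_on S - {p}" using H0 S by simp
      show "g differentiable_on {0..1}"
        using C1
        by (auto simp: differentiable_on_def C1_differentiable_on_eq intro: differentiable_at_withinI)
      show "g s \<noteq> p" if s: "s \<in> {0<..<1}" for s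
        using g_eq_interior[OF s, of 0] g_eq_interior[OF s, of 1] s True by auto
      show "ennreal (norm (H0 w)) \<le> ennreal M * (1 + (\<integral>\<^sup>+s. inverse (ennreal (norm (g s - w))) * indicator {0..1} s \<partial>lborel))"
        if w: "w \<in> S - {p}" "w \<notin> g ` {0..1}" for w
        using H0(2)[of w] M(2)[of w] w S by (auto simp: path_image_def)
    qed
    then obtain G where G: "G holomorphic_on S" "\<And>z. z \<in> S - {p} \<Longrightarrow> G z = H0 z"
      using holomorphic_on_extend_lim[of H0 S p] H0 S by (metis interior_open)
    obtain r where r: "0 < r" "ball p r \<subseteq> S"
      using S openE by blast
    have "G w = h w" if w: "w \<in> ball p r - path_image g" for w
    proof -
      have "w \<in> S - {p}" using w r True ends by auto
      then show ?thesis using G(2)[of w] H0(2)[of w] S w by auto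
    qed
    then show ?thesis
      using r G(1) holomorphic_on_subset by blast
  qed (use p loc in auto)
  show ?thesis
    by (rule holomorphic_glue[of "ball 0 1" "path_image g" h])
       (use loc' closure_compl_curve that in auto)
qed

section \<open>The kernel integral as a Taylor remainder\<close>

lemma contour_integrable_continuous:
  assumes "continuous_on (path_image g) f"
  shows "f contour_integrable_on g"
proof -
  have "continuous_on {0..1} (\<lambda>s. f (g s))"
    using continuous_on_compose2[OF assms continuous_g] by (simp add: path_image_def)
  then have "(\<lambda>s. f (g s) * tangent s) integrable_on {0..1}"
    by (intro integrable_continuous_real continuous_on_mult continuous_tangent)
  then show ?thesis
    by (simp add: contour_integrable_on tangent_def)
qed

lemma continuous_u_path: "continuous_on (path_image g) u"
  using cont_u curve_in_closure continuous_on_subset by blast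

text \<open>These are the integrals that arise in the geometric expansion of the kernel; the formula
  recognises them as Taylor coefficients of C.\<close>

lemma higher_deriv_C:
  assumes "w \<notin> path_image g"
  shows "(deriv ^^ k) C w = fact k / (2 * of_real pi * \<i>) * contour_integral g (\<lambda>\<zeta>. u \<zeta> / (\<zeta> - w) ^ Suc k)"
  using assms
proof (induction k arbitrary: w)
  case 0
  then show ?case by (simp add: C_def)
next
  case (Suc k)
  have vp: "valid_path g"
    using C1 by (simp add: valid_path_def C1_differentiable_imp_piecewise)
  obtain B where B: "\<And>s. s \<in> {0..1} \<Longrightarrow> norm (tangent s) \<le> B"
    using compact_norm_bound[OF continuous_tangent] by auto
  have "((\<lambda>w. contour_integral g (\<lambda>\<zeta>. u \<zeta> / (\<zeta> - w) ^ Suc k)) has_field_derivative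
      of_nat (Suc k) * contour_integral g (\<lambda>\<zeta>. u \<zeta> / (\<zeta> - w) ^ Suc (Suc k))) (at w)"
  proof (rule Cauchy_next_derivative(2)[where S = UNIV and B = B])
    show "((\<lambda>\<zeta>. u \<zeta> / (\<zeta> - x) ^ Suc k) has_contour_integral contour_integral g (\<lambda>\<zeta>. u \<zeta> / (\<zeta> - x) ^ Suc k)) g"
      if "x \<in> UNIV - path_image g" for x
      by (intro has_contour_integral_integral contour_integrable_continuous continuous_intros continuous_u_path)
         (use that in auto)
  qed (use continuous_u_path B vp Suc.prems in \<open>auto simp: tangent_def\<close>)
  from DERIV_cmult[OF this, of "fact k / (2 * of_real pi * \<i>)"]
  have "((\<lambda>w. fact k / (2 * of_real pi * \<i>) * contour_integral g (\<lambda>\<zeta>. u \<zeta> / (\<zeta> - w) ^ Suc k)) has_field_derivative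
      fact (Suc k) / (2 * of_real pi * \<i>) * contour_integral g (\<lambda>\<zeta>. u \<zeta> / (\<zeta> - w) ^ Suc (Suc k))) (at w)"
    by (simp add: mult_ac)
  moreover have "open (- path_image g)" "w \<in> - path_image g"
    using closed_path_image_g Suc.prems by auto
  ultimately have "((deriv ^^ k) C has_field_derivative
      fact (Suc k) / (2 * of_real pi * \<i>) * contour_integral g (\<lambda>\<zeta>. u \<zeta> / (\<zeta> - w) ^ Suc (Suc k))) (at w)"
    by (rule has_field_derivative_transform_within_open) (use Suc.IH in simp)
  then show ?case
    by (simp add: DERIV_imp_deriv)
qed

text \<open>Expanding the kernel as a geometric sum turns the integral into the Cauchy
  integral minus a Taylor polynomial of \<open>H\<close> at \<open>a\<close>.\<close>

lemma kernel_integral: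
  assumes H: "H holomorphic_on ball 0 1" "\<And>w. w \<in> ball 0 1 - path_image g \<Longrightarrow> H w = h w"
    and z: "z \<in> D" and a: "a \<in> ball 0 1" "a \<notin> path_image g" "a \<notin> D"
  shows "1 / (2 * of_real pi * \<i>) *
      contour_integral g (\<lambda>\<zeta>. u \<zeta> / (\<zeta> - z) * ((z - a) / (\<zeta> - a)) ^ n)
    = u z + (H z - (\<Sum>k<n. (deriv ^^ k) H a / fact k * (z - a) ^ k))"
proof -
  have zP: "z \<notin> path_image g" "z \<in> ball 0 1" using z D_subset by auto
  \<comment> \<open>A whole disc around a lies off \<Gamma> and D; there h equals C, so all
    derivatives at a agree.\<close>
  have coeff: "(deriv ^^ k) H a = (deriv ^^ k) C a" for k
  proof (rule higher_deriv_cong_ev[OF _ refl])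
    obtain r where r: "0 < r" "ball a r \<subseteq> ball 0 1 - path_image g"
      using a open_disk_minus_curve openE by blast
    have disj: "ball a r \<inter> D = {}"
      using ball_in_or_out[OF r(2)] r(1) a(3) by (metis centre_in_ball subsetD)
    have "H x = C x" if x: "x \<in> ball a r" for x
    proof -
      have "x \<in> ball 0 1 - path_image g" "x \<notin> D" using x r(2) disj by blast+
      with H(2)[of x] show ?thesis by (simp add: h_def)
    qed
    then show "\<forall>\<^sub>F x in nhds a. H x = C x"
      using r(1) by (intro eventually_nhds[THEN iffD2] exI[of _ "ball a r"]) auto
  qed
  have int: "(\<lambda>\<zeta>. u \<zeta> / (\<zeta> - a) ^ Suc k) contour_integrable_on g" for k
    by (intro contour_integrable_continuous continuous_intros continuous_u_path) (use a in auto)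
  have intz: "(\<lambda>\<zeta>. u \<zeta> / (\<zeta> - z)) contour_integrable_on g"
    by (intro contour_integrable_continuous continuous_intros continuous_u_path) (use zP in auto)
  have expand: "u \<zeta> / (\<zeta> - z) * ((z - a) / (\<zeta> - a)) ^ n =
      u \<zeta> / (\<zeta> - z) - (\<Sum>k<n. (z - a) ^ k * (u \<zeta> / (\<zeta> - a) ^ Suc k))"
    if "\<zeta> \<in> path_image g" for \<zeta>
  proof (induction n)
    case (Suc n)
    have ne: "\<zeta> - z \<noteq> 0" "\<zeta> - a \<noteq> 0" using that zP a by auto
    have "u \<zeta> / (\<zeta> - z) * ((z - a) / (\<zeta> - a)) ^ Suc n =
        (u \<zeta> * ((z - a) / (\<zeta> - a)) ^ n) * ((z - a) / ((\<zeta> - z) * (\<zeta> - a)))"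
      by simp
    also have "(z - a) / ((\<zeta> - z) * (\<zeta> - a)) = 1 / (\<zeta> - z) - 1 / (\<zeta> - a)"
      using ne by (simp add: divide_simps)
    also have "(u \<zeta> * ((z - a) / (\<zeta> - a)) ^ n) * (1 / (\<zeta> - z) - 1 / (\<zeta> - a)) =
        u \<zeta> / (\<zeta> - z) * ((z - a) / (\<zeta> - a)) ^ n - (z - a) ^ n * (u \<zeta> / (\<zeta> - a) ^ Suc n)"
    proof -
      have "(U * (P / Y) ^ n) * (1 / X - 1 / Y) = U / X * (P / Y) ^ n - P ^ n * (U / Y ^ Suc n)"
        for U P X Y :: complex
        by (simp add: right_diff_distrib diff_divide_distrib power_divide mult_ac)
      then show ?thesis .
    qed
    finally show ?case
      by (simp only: Suc.IH sum.lessThan_Suc diff_diff_eq)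
  qed simp
  have "contour_integral g (\<lambda>\<zeta>. u \<zeta> / (\<zeta> - z) * ((z - a) / (\<zeta> - a)) ^ n) =
      contour_integral g (\<lambda>\<zeta>. u \<zeta> / (\<zeta> - z) - (\<Sum>k<n. (z - a) ^ k * (u \<zeta> / (\<zeta> - a) ^ Suc k)))"
    by (rule contour_integral_cong[OF refl expand])
  also have "\<dots> = contour_integral g (\<lambda>\<zeta>. u \<zeta> / (\<zeta> - z)) -
      (\<Sum>k<n. (z - a) ^ k * contour_integral g (\<lambda>\<zeta>. u \<zeta> / (\<zeta> - a) ^ Suc k))"
  proof -
    have "(\<lambda>\<zeta>. (z - a) ^ k * (u \<zeta> / (\<zeta> - a) ^ Suc k)) contour_integrable_on g" for k
      by (rule contour_integrable_lmul[OF int])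
    note * = finite_lessThan this
    show ?thesis
      unfolding contour_integral_diff[OF intz contour_integrable_sum[OF *]] contour_integral_sum[OF *]
        contour_integral_lmul[OF int] ..
  qed
  finally have "1 / (2 * of_real pi * \<i>) *
      contour_integral g (\<lambda>\<zeta>. u \<zeta> / (\<zeta> - z) * ((z - a) / (\<zeta> - a)) ^ n) =
      C z - (\<Sum>k<n. 1 / (2 * of_real pi * \<i>) * ((z - a) ^ k * contour_integral g (\<lambda>\<zeta>. u \<zeta> / (\<zeta> - a) ^ Suc k)))"
    by (simp only: right_diff_distrib C_def sum_distrib_left)
  also have "(\<Sum>k<n. 1 / (2 * of_real pi * \<i>) * ((z - a) ^ k * contour_integral g (\<lambda>\<zeta>. u \<zeta> / (\<zeta> - a) ^ Suc k))) =
      (\<Sum>k<n. (deriv ^^ k) H a / fact k * (z - a) ^ k)"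
    unfolding coeff higher_deriv_C[OF a(2)] by (intro sum.cong) (simp_all del: power_Suc)
  \<comment> \<open>z lies in D, where H is C minus u: this is the origin of the main term
    \<open>u z\<close>.\<close>
  also have "C z = H z + u z"
    using H(2)[of z] zP z by (simp add: h_def)
  finally show ?thesis by simp
qed

end

section \<open>Taylor remainders and transversality\<close>

text \<open>Cauchy's inequalities bound the series termwise by \<open>M * q ^ k\<close>. The bound
  depends on a only through M, r and q, so it is uniform when the center moves with N.\<close>

lemma Taylor_remainder_le:
  fixes f :: "complex \<Rightarrow> complex"
  assumes f: "f holomorphic_on ball a r" "continuous_on (cball a r) f" and r: "0 < r"
    and M: "\<And>x. norm (a - x) = r \<Longrightarrow> norm (f x) \<le> M"
    and q: "0 \<le> q" "q < 1" and z: "norm (z - a) \<le> q * r"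
  shows "norm (f z - (\<Sum>k<n. (deriv ^^ k) f a / fact k * (z - a) ^ k)) \<le> M * q ^ n / (1 - q)"
proof -
  let ?t = "\<lambda>k. (deriv ^^ k) f a / fact k * (z - a) ^ k"
  have "q * r < 1 * r" using q r by (intro mult_strict_right_mono) auto
  then have "z \<in> ball a r"
    using z by (simp add: dist_norm norm_minus_commute)
  then have sums: "?t sums f z"
    by (rule holomorphic_power_series[OF f(1)])
  have t: "norm (?t k) \<le> M * q ^ k" for k
  proof -
    have "norm ((deriv ^^ k) f a) \<le> fact k * M / r ^ k"
      by (rule Cauchy_inequality[OF f r M])
    moreover have "0 \<le> M"
      using order_trans[OF norm_ge_zero M[of "a + of_real r"]] r by simp
    ultimately have "norm (?t k) \<le> (fact k * M / r ^ k) / fact k * (q * r) ^ k"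
      unfolding norm_mult norm_divide norm_power norm_fact
      using z r by (intro mult_mono divide_right_mono power_mono) (auto intro: order_trans[OF norm_ge_zero])
    then show ?thesis using r by (simp add: power_mult_distrib)
  qed
  have "f z - (\<Sum>k<n. ?t k) = (\<Sum>k. ?t (k + n))"
    using suminf_minus_initial_segment[of ?t n] sums by (simp add: sums_iff)
  also have "norm \<dots> \<le> (\<Sum>k. M * q ^ n * q ^ k)"
  proof (rule norm_suminf_le)
    show "norm (?t (k + n)) \<le> M * q ^ n * q ^ k" for k
      using t[of "k + n"] by (simp add: power_add mult_ac)
    show "summable (\<lambda>k. M * q ^ n * q ^ k)"
      using q by (intro summable_mult summable_geometric) auto
  qed
  also have "\<dots> = M * q ^ n / (1 - q)"
    using q by (simp add: suminf_mult summable_geometric suminf_geometric)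
  finally show ?thesis .
qed

section \<open>Separation of \<gamma> from \<Gamma> near the origin\<close>

lemma has_vector_derivative_imp_quotient_LIMSEQ:
  fixes f :: "real \<Rightarrow> complex"
  assumes f: "(f has_vector_derivative f') (at x)" and X: "X \<longlonglongrightarrow> x" "\<And>n. X n \<noteq> x"
  shows "(\<lambda>n. (f (X n) - f x) / of_real (X n - x)) \<longlonglongrightarrow> f'"
proof -
  have "filterlim X (at x) sequentially"
    using X by (intro filterlim_atI) auto
  moreover have "((\<lambda>y. (Re (f y) - Re (f x)) / (y - x)) \<longlongrightarrow> Re f') (at x)"
    "((\<lambda>y. (Im (f y) - Im (f x)) / (y - x)) \<longlongrightarrow> Im f') (at x)"
    using bounded_linear.has_vector_derivative[OF bounded_linear_Re f]
      bounded_linear.has_vector_derivative[OF bounded_linear_Im f]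
    by (simp_all add: has_real_derivative_iff_has_vector_derivative[symmetric] has_field_derivative_iff)
  ultimately have "(\<lambda>n. Complex ((Re (f (X n)) - Re (f x)) / (X n - x)) ((Im (f (X n)) - Im (f x)) / (X n - x)))
      \<longlonglongrightarrow> Complex (Re f') (Im f')"
    by (intro tendsto_Complex) (auto elim: filterlim_compose)
  moreover have "Complex ((Re (f (X n)) - Re (f x)) / (X n - x)) ((Im (f (X n)) - Im (f x)) / (X n - x)) =
      (f (X n) - f x) / of_real (X n - x)" for n
    by (simp add: complex_eq_iff Re_divide_of_real Im_divide_of_real)
  ultimately show ?thesis by simp
qed

text \<open>\<open>Im (v * cnj q)\<close> is, up to sign, the determinant of q and v as plane
  vectors. If it vanished, the span would stay in the line through q, which misses
  \<open>\<i> * q\<close>.\<close>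

lemma span_eq_UNIV_imp:
  fixes v q :: complex
  assumes "span {q, v} = UNIV" "q \<noteq> 0"
  shows "Im (v * cnj q) \<noteq> 0"
proof
  assume 0: "Im (v * cnj q) = 0"
  have "span {q, v} \<subseteq> {w. Im (w * cnj q) = 0}"
  proof (rule span_minimal)
    show "subspace {w. Im (w * cnj q) = 0}"
      by (auto simp: subspace_def algebra_simps)
  qed (use 0 in \<open>auto simp: complex_mult_cnj\<close>)
  then have "\<i> * q \<in> {w. Im (w * cnj q) = 0}" using assms by blast
  then have "(Re q)\<^sup>2 + (Im q)\<^sup>2 = 0" by (simp add: power2_eq_square)
  then show False using assms(2) by (simp add: complex_eq_iff sum_power2_eq_zero_iff)
qed

text \<open>Common points accumulating at the origin would make the secants of both curves parallel,
  hence in the limit the tangents. Parameter 0 has to be excluded if \<Gamma> contains the origin,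
  because \<open>\<gamma> 0 = 0\<close> would put the singularity of the kernel on \<Gamma>.\<close>

lemma (in lune_domain) eventually_not_on_curve:
  assumes \<gamma>: "smooth_curve_from_origin \<gamma>" and tr: "transversal_at_origin g \<gamma>"
    and t: "\<And>N. 0 \<le> t N" "(\<lambda>N. \<gamma> (t N)) \<longlonglongrightarrow> 0"
    and nz: "0 \<in> curve_in_disk g \<Longrightarrow> \<forall>\<^sub>F N in sequentially. t N \<noteq> 0"
  shows "\<forall>\<^sub>F N in sequentially. \<gamma> (t N) \<notin> path_image g"
proof (cases "0 \<in> path_image g")
  case False
  then have "\<forall>\<^sub>F N in sequentially. \<gamma> (t N) \<in> - path_image g"
    using closed_path_image_g t(2) by (intro topological_tendstoD) auto
  then show ?thesis by simp
next
  case True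
  then have "\<forall>\<^sub>F N in sequentially. t N \<noteq> 0"
    by (intro nz) (simp add: curve_in_disk_def)
  moreover have "\<forall>\<^sub>F N in sequentially. t N = 0 \<or> \<gamma> (t N) \<notin> path_image g"
  proof (rule ccontr)
    assume "\<not> ?thesis"
    then obtain r :: "nat \<Rightarrow> nat" where r: "strict_mono r" "\<And>n. t (r n) \<noteq> 0" "\<And>n. \<gamma> (t (r n)) \<in> path_image g"
      using not_eventually_sequentiallyD[of "\<lambda>N. t N = 0 \<or> \<gamma> (t N) \<notin> path_image g"] by auto
    then have "\<forall>n. \<exists>s\<in>{0..1}. g s = \<gamma> (t (r n))"
      by (metis imageE path_image_def)
    then obtain s where s: "\<And>n. s n \<in> {0..1}" "\<And>n. g (s n) = \<gamma> (t (r n))" by metis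
    have "seq_compact {0..1::real}"
      using compact_Icc compact_imp_seq_compact by blast
    then obtain l r' where l: "l \<in> {0..1}" "strict_mono r'" "(s \<circ> r') \<longlonglongrightarrow> l"
      using seq_compactE s(1) by metis
    define \<tau> where "\<tau> n = t (r (r' n))" for n
    define \<sigma> where "\<sigma> n = s (r' n)" for n
    have g\<sigma>: "g (\<sigma> n) = \<gamma> (\<tau> n)" for n
      by (simp add: \<sigma>_def \<tau>_def s)
    obtain k where k: "homeomorphism {0..} (\<gamma> ` {0..}) \<gamma> k"
      using \<gamma> by (auto simp: smooth_curve_from_origin_def)
    have \<gamma>0: "\<gamma> 0 = 0" and \<gamma>1: "\<gamma> C1_differentiable_on {0..}"
      using \<gamma> by (auto simp: smooth_curve_from_origin_def)
    have \<tau>pos: "\<tau> n \<ge> 0" "\<tau> n \<noteq> 0" for n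
      using t(1) r(2) by (auto simp: \<tau>_def)
    have k\<gamma>: "k (\<gamma> x) = x" if "x \<ge> 0" for x
      using k that by (auto simp: homeomorphism_def)
    have \<gamma>\<tau>: "(\<lambda>n. \<gamma> (\<tau> n)) \<longlonglongrightarrow> 0"
      using LIMSEQ_subseq_LIMSEQ[OF LIMSEQ_subseq_LIMSEQ[OF t(2) r(1)] l(2)] by (simp add: o_def \<tau>_def)
    \<comment> \<open>Continuity of the inverse of \<gamma> turns convergence of the points into
      convergence of the parameters; an injective \<gamma> alone could return towards the origin as
      the parameter tends to infinity.\<close>
    have "(\<lambda>n. k (\<gamma> (\<tau> n))) \<longlonglongrightarrow> k (\<gamma> 0)"
      by (rule continuous_on_tendsto_compose[of "\<gamma> ` {0..}"])
         (use k \<gamma>\<tau> \<gamma>0 \<tau>pos in \<open>auto simp: homeomorphism_def\<close>)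
    then have \<tau>0: "\<tau> \<longlonglongrightarrow> 0"
      using k\<gamma> \<tau>pos by simp
    have \<sigma>l: "\<sigma> \<longlonglongrightarrow> l"
      using l(3) by (simp add: o_def \<sigma>_def[abs_def])
    have "(\<lambda>n. g (\<sigma> n)) \<longlonglongrightarrow> g l"
      by (rule continuous_on_tendsto_compose[OF continuous_g \<sigma>l l(1) always_eventually])
         (simp only: \<sigma>_def s(1) simp_thms)
    with \<gamma>\<tau> have gl: "g l = 0"
      unfolding g\<sigma> by (rule LIMSEQ_unique[symmetric])
    have \<sigma>ne: "\<sigma> n \<noteq> l" for n
    proof
      assume "\<sigma> n = l"
      then have "\<gamma> (\<tau> n) = \<gamma> 0" using g\<sigma>[of n] gl \<gamma>0 by simp
      then have "\<tau> n = 0" using k\<gamma>[of "\<tau> n"] k\<gamma>[of 0] \<tau>pos by simp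
      then show False using \<tau>pos by simp
    qed
    define v where "v = vector_derivative \<gamma> (at 0)"
    have "(\<gamma> has_vector_derivative v) (at 0)"
      using \<gamma>1 by (simp add: C1_differentiable_on_eq v_def vector_derivative_works)
    from has_vector_derivative_imp_quotient_LIMSEQ[OF this \<tau>0] \<tau>pos \<gamma>0
    have "(\<lambda>n. \<gamma> (\<tau> n) / of_real (\<tau> n)) \<longlonglongrightarrow> v" by simp
    moreover from has_vector_derivative_imp_quotient_LIMSEQ[OF has_tangent[OF l(1)] \<sigma>l \<sigma>ne] gl
    have "(\<lambda>n. g (\<sigma> n) / of_real (\<sigma> n - l)) \<longlonglongrightarrow> tangent l" by simp
    ultimately have "(\<lambda>n. Im (\<gamma> (\<tau> n) / of_real (\<tau> n) * cnj (g (\<sigma> n) / of_real (\<sigma> n - l)))) \<longlonglongrightarrow> Im (v * cnj (tangent l))"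
      by (intro tendsto_intros)
    \<comment> \<open>Both secants are real multiples of the same vector
      \<open>\<gamma> (\<tau> n) = g (\<sigma> n)\<close>, so the product is real.\<close>
    moreover have "Im (\<gamma> (\<tau> n) / of_real (\<tau> n) * cnj (g (\<sigma> n) / of_real (\<sigma> n - l))) = 0" for n
    proof -
      have "\<gamma> (\<tau> n) / of_real (\<tau> n) * cnj (g (\<sigma> n) / of_real (\<sigma> n - l)) =
          of_real ((norm (\<gamma> (\<tau> n)))\<^sup>2 / (\<tau> n * (\<sigma> n - l)))"
        unfolding g\<sigma> using complex_norm_square[of "\<gamma> (\<tau> n)"] by simp
      then show ?thesis by (metis Im_complex_of_real)
    qed
    ultimately have "Im (v * cnj (tangent l)) = 0"
      by (simp only: LIMSEQ_const_iff)
    moreover have "span {tangent l, v} = UNIV"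
      using tr l(1) gl unfolding transversal_at_origin_def v_def tangent_def by blast
    ultimately show False
      using span_eq_UNIV_imp tangent_nonzero l(1) by blast
  qed
  ultimately show ?thesis
    by eventually_elim auto
qed

section \<open>Convergence on compact sets\<close>

theorem theorem2p2:
  fixes g \<gamma> :: "real \<Rightarrow> complex" and D :: "complex set"
    and t :: "nat \<Rightarrow> real" and u :: "complex \<Rightarrow> complex"
  defines "I \<equiv> \<lambda>N z. 1 / (2 * of_real pi * \<i>) *
      contour_integral g
        (\<lambda>\<zeta>. u \<zeta> / (\<zeta> - z) * ((z - \<gamma> (t N)) / (\<zeta> - \<gamma> (t N))) ^ (N + 1))"
  assumes "lune g D"
    and "smooth_curve_from_origin \<gamma>"
    and "\<gamma> ` {0..} \<subseteq> ball 0 1 - D"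
    and "transversal_at_origin g \<gamma>"
    and "\<And>N. t N \<ge> 0"
    and "(\<lambda>N. \<gamma> (t N)) \<longlonglongrightarrow> 0"
    and "0 \<in> curve_in_disk g \<Longrightarrow> \<forall>\<^sub>F N in sequentially. t N \<noteq> 0"
    and "u holomorphic_on D"
    and "continuous_on (closure D) u"
  shows "(\<forall>z\<in>D. (\<lambda>N. I N z) \<longlonglongrightarrow> u z) \<and>
    (\<forall>K. compact K \<and> K \<subseteq> D \<longrightarrow> uniform_limit K I u sequentially)"
proof -
  interpret lune_function g D u
    using assms by unfold_locales auto
  define a where "a N = \<gamma> (t N)" for N
  have a: "a N \<in> ball 0 1" "a N \<notin> D" for N
  proof -
    have "\<gamma> (t N) \<in> \<gamma> ` {0..}" using assms(6) by simp
    with assms(4) show "a N \<in> ball 0 1" "a N \<notin> D" unfolding a_def by blast+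
  qed
  have a0: "a \<longlonglongrightarrow> 0"
    using assms(7) by (simp add: a_def[abs_def])
  have aP: "\<forall>\<^sub>F N in sequentially. a N \<notin> path_image g"
    unfolding a_def by (rule eventually_not_on_curve[OF assms(3,5-8)])
  obtain H where H: "H holomorphic_on ball 0 1" "\<And>w. w \<in> ball 0 1 - path_image g \<Longrightarrow> H w = h w"
    using holomorphic_extension by blast
  have unif: "uniform_limit K I u sequentially" if K: "compact K" "K \<subseteq> D" for K
  proof -
    obtain \<rho> where \<rho>: "0 \<le> \<rho>" "\<rho> < 1" "\<And>z. z \<in> K \<Longrightarrow> norm z \<le> \<rho>"
    proof (cases "K = {}")
      case False
      then obtain x where "x \<in> K" "\<And>z. z \<in> K \<Longrightarrow> norm z \<le> norm x"
        using continuous_attains_sup[OF K(1) False, of norm] by (auto intro: continuous_intros)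
      moreover from this have "norm x < 1" using K(2) D_subset by force
      ultimately show ?thesis by (intro that[of "norm x"]) auto
    qed (auto intro: that[of 0])
    \<comment> \<open>The gap between K and the unit circle is divided into four parts \<epsilon>.
      Then \<open>norm z \<le> 1 - 4 * \<epsilon>\<close> and \<open>norm (a N) < \<epsilon>\<close>
      give \<open>norm (z - a N) \<le> 1 - 3 * \<epsilon> = q * r\<close>, while the closed disc of
      radius \<open>r = 1 - 2 * \<epsilon>\<close> about \<open>a N\<close> stays in
      \<open>cball 0 (1 - \<epsilon>)\<close>. One M thus serves all large N.\<close>
    define \<epsilon> where "\<epsilon> = (1 - \<rho>) / 4"
    define r where "r = 1 - 2 * \<epsilon>"
    define q where "q = (1 - 3 * \<epsilon>) / r"
    have \<epsilon>: "0 < \<epsilon>" "\<rho> = 1 - 4 * \<epsilon>" "4 * \<epsilon> \<le> 1" using \<rho> by (simp_all add: \<epsilon>_def field_simps)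
    have r: "0 < r" and q: "0 \<le> q" "q < 1" "q * r = 1 - 3 * \<epsilon>"
      using \<epsilon> by (auto simp: r_def q_def)
    have cb: "cball 0 (1 - \<epsilon>) \<subseteq> ball (0::complex) 1" using \<epsilon> by auto
    have HC: "continuous_on (ball 0 1) H"
      using H(1) holomorphic_on_imp_continuous_on by blast
    then obtain M where M: "\<And>x. x \<in> cball 0 (1 - \<epsilon>) \<Longrightarrow> norm (H x) \<le> M"
      using compact_norm_bound[OF continuous_on_subset[OF HC cb] compact_cball] by blast
    have "\<forall>\<^sub>F N in sequentially. norm (a N) < \<epsilon>"
      using tendstoD[OF a0 \<epsilon>(1)] by simp
    with aP have ev: "\<forall>\<^sub>F N in sequentially. \<forall>z\<in>K. dist (I N z) (u z) \<le> M * q ^ (N + 1) / (1 - q)"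
    proof eventually_elim
      case (elim N)
      have sub: "cball (a N) r \<subseteq> cball 0 (1 - \<epsilon>)"
        using elim(2) by (auto simp: cball_subset_cball_iff r_def)
      show ?case
      proof
        fix z assume z: "z \<in> K"
        have "norm (H z - (\<Sum>k<N+1. (deriv ^^ k) H (a N) / fact k * (z - a N) ^ k)) \<le> M * q ^ (N + 1) / (1 - q)"
        proof (rule Taylor_remainder_le[OF _ _ r _ q(1,2)])
          show "H holomorphic_on ball (a N) r"
            using H(1) sub cb ball_subset_cball by (meson holomorphic_on_subset order_trans)
          show "continuous_on (cball (a N) r) H"
            using HC sub cb by (meson continuous_on_subset order_trans)
          show "norm (H x) \<le> M" if "norm (a N - x) = r" for x
            using that sub by (intro M) (auto simp: dist_norm)
          have "norm (z - a N) \<le> norm z + norm (a N)" by (rule norm_triangle_ineq4)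
          also have "\<dots> \<le> q * r"
            using \<rho>(3)[OF z] elim(2) \<epsilon>(2) q(3) by linarith
          finally show "norm (z - a N) \<le> q * r" .
        qed
        moreover have "I N z = u z + (H z - (\<Sum>k<N+1. (deriv ^^ k) H (a N) / fact k * (z - a N) ^ k))"
          unfolding I_def a_def[symmetric]
          by (rule kernel_integral[OF H]) (use z K a elim(1) in auto)
        ultimately show "dist (I N z) (u z) \<le> M * q ^ (N + 1) / (1 - q)"
          by (simp add: dist_norm)
      qed
    qed
    have "(\<lambda>N. M * q ^ (N + 1) / (1 - q)) \<longlonglongrightarrow> M * 0 / (1 - q)"
      using q by (intro tendsto_intros LIMSEQ_ignore_initial_segment[OF LIMSEQ_realpow_zero]) auto
    then have lim: "(\<lambda>N. M * q ^ (N + 1) / (1 - q)) \<longlonglongrightarrow> 0" by simp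
    show ?thesis
    proof (rule uniform_limitI)
      fix e :: real assume "0 < e"
      from order_tendstoD(2)[OF lim this] ev
      show "\<forall>\<^sub>F N in sequentially. \<forall>z\<in>K. dist (I N z) (u z) < e"
        by eventually_elim force
    qed
  qed
  have "(\<lambda>N. I N z) \<longlonglongrightarrow> u z" if "z \<in> D" for z
    using tendsto_uniform_limitI[OF unif[of "{z}"]] that by auto
  with unif show ?thesis by blast
qed

end
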